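(* Let $P$ be a finite poset with least element $0$. Then the zero-divisor graph $G(P)$ satisfies the Total Coloring Conjecture. Moreover, if $P$ is a finite $0$-distributive poset, then the complement $G^c(P)$ satisfies the Total Coloring Conjecture.
   Context: For $A\subseteq P$, $A^\ell=\{b\in P: b\le a\ \forall a\in A\}$ and $A^u=\{b\in P: b\ge a\ \forall a\in A\}$ (so $\emptyset^\ell=P$). A poset $P$ with $0$ is $0$-distributive if for all $a,b,c\in P$, $\{a,b\}^\ell=\{0\}=\{a,c\}^\ell$ implies $(\{a\}\cup\{b,c\}^u)^\ell=\{0\}$. The zero-divisors are $Z(P)=\{a\in P:\exists\, b\in P\setminus\{0\},\ \{a,b\}^\ell=\{0\}\}$. The zero-divisor graph $G(P)$ is the simple graph with vertex set $Z(P)\setminus\{0\}$, with $a,b$ adjacent iff $\{a,b\}^\ell=\{0\}$; $G^c(P)$ is its complement. A total coloring of a finite simple graph $G$ colors vertices and edges so that adjacent vertices, edges sharing an endpoint, and a vertex and an edge incident to it always get different colors; $\chi''(G)$ is the minimum number of colors, and $\Delta(G)$ the maximum degree. $G$ satisfies the Total Coloring Conjecture if $\chi''(G)=\Delta(G)+1$ or $\chi''(G)=\Delta(G)+2$. The null graph (no vertices) is regarded as trivially satisfying it. *)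

theory Defs
  imports Main
begin

section \<open>Finite simple graphs and total colourings\<close>

record 'a graph =
  verts :: "'a set"
  edges :: "'a set set"

definition finite_simple_graph :: "'a graph \<Rightarrow> bool" where
  "finite_simple_graph G \<longleftrightarrow>
     finite (verts G) \<and> (\<forall>e \<in> edges G. e \<subseteq> verts G \<and> card e = 2)"

definition complement :: "'a graph \<Rightarrow> 'a graph" where
  "complement G =
     \<lparr>verts = verts G,
      edges = {{a, b} |a b. a \<in> verts G \<and> b \<in> verts G \<and> a \<noteq> b \<and> {a, b} \<notin> edges G}\<rparr>"

definition degree :: "'a graph \<Rightarrow> 'a \<Rightarrow> nat" where
  "degree G v = card {e \<in> edges G. v \<in> e}"

definition max_degree :: "'a graph \<Rightarrow> nat" where
  "max_degree G = Max (degree G ` verts G)"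

text \<open>The vertex part \<open>f\<close> and the edge part \<open>g\<close> of a colouring take their values in the
  same set of \<open>k\<close> colours.\<close>

definition total_colouring :: "'a graph \<Rightarrow> nat \<Rightarrow> ('a \<Rightarrow> nat) \<Rightarrow> ('a set \<Rightarrow> nat) \<Rightarrow> bool" where
  "total_colouring G k f g \<longleftrightarrow>
     f ` verts G \<subseteq> {..<k} \<and> g ` edges G \<subseteq> {..<k} \<and>
     (\<forall>u \<in> verts G. \<forall>v \<in> verts G. {u, v} \<in> edges G \<longrightarrow> f u \<noteq> f v) \<and>
     (\<forall>e \<in> edges G. \<forall>e' \<in> edges G. e \<noteq> e' \<and> e \<inter> e' \<noteq> {} \<longrightarrow> g e \<noteq> g e') \<and>
     (\<forall>v \<in> verts G. \<forall>e \<in> edges G. v \<in> e \<longrightarrow> f v \<noteq> g e)"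

definition total_chromatic_number :: "'a graph \<Rightarrow> nat" where
  "total_chromatic_number G = (LEAST k. \<exists>f g. total_colouring G k f g)"

text \<open>The null graph satisfies the conjecture by convention.  It is treated separately
  since \<^const>\<open>max_degree\<close> is unspecified there.\<close>

definition satisfies_TCC :: "'a graph \<Rightarrow> bool" where
  "satisfies_TCC G \<longleftrightarrow>
     verts G = {} \<or>
     total_chromatic_number G = max_degree G + 1 \<or>
     total_chromatic_number G = max_degree G + 2"

section \<open>Zero-divisor graphs of posets\<close>

text \<open>A poset is a relation \<open>r\<close> with \<^term>\<open>Partial_order r\<close>.  Its ground set is
  \<^term>\<open>Field r\<close>, which loses nothing because \<open>r\<close> is reflexive.  The cones
  \<open>A\<^sup>\<ell>\<close> and \<open>A\<^sup>u\<close> are \<^term>\<open>Under r A\<close> and \<^term>\<open>Above r A\<close>.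
  The parameter \<open>z\<close> below stands for the least element \<open>0\<close>.\<close>

definition is_least_element :: "'a rel \<Rightarrow> 'a \<Rightarrow> bool" where
  "is_least_element r z \<longleftrightarrow> z \<in> Field r \<and> (\<forall>a \<in> Field r. (z, a) \<in> r)"

definition zero_distributive :: "'a rel \<Rightarrow> 'a \<Rightarrow> bool" where
  "zero_distributive r z \<longleftrightarrow>
     (\<forall>a \<in> Field r. \<forall>b \<in> Field r. \<forall>c \<in> Field r.
        Under r {a, b} = {z} \<and> Under r {a, c} = {z} \<longrightarrow>
        Under r ({a} \<union> Above r {b, c}) = {z})"

definition zero_divisors :: "'a rel \<Rightarrow> 'a \<Rightarrow> 'a set" where
  "zero_divisors r z = {a \<in> Field r. \<exists>b \<in> Field r - {z}. Under r {a, b} = {z}}"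

text \<open>The condition \<^term>\<open>a \<noteq> b\<close> in the edge set is redundant, since
  \<^term>\<open>Under r {a, a} = {z}\<close> only for \<^term>\<open>a = z\<close>.\<close>

definition zero_divisor_graph :: "'a rel \<Rightarrow> 'a \<Rightarrow> 'a graph" where
  "zero_divisor_graph r z =
     \<lparr>verts = zero_divisors r z - {z},
      edges = {{a, b} |a b. a \<in> zero_divisors r z - {z} \<and> b \<in> zero_divisors r z - {z} \<and>
                 a \<noteq> b \<and> Under r {a, b} = {z}}\<rparr>"

section \<open>Well-definedness\<close>

lemma finite_simple_graph_zero_divisor_graph:
  assumes "finite (Field r)"
  shows "finite_simple_graph (zero_divisor_graph r z)"
proof -
  let ?G = "zero_divisor_graph r z"
  have "verts ?G \<subseteq> Field r"
    unfolding zero_divisor_graph_def zero_divisors_def graph.simps by blast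
  then have "finite (verts ?G)" using assms by (rule finite_subset)
  moreover have "e \<subseteq> verts ?G \<and> card e = 2" if "e \<in> edges ?G" for e
  proof -
    obtain a b where "e = {a, b}" "a \<in> verts ?G" "b \<in> verts ?G" "a \<noteq> b"
      using \<open>e \<in> edges ?G\<close> unfolding zero_divisor_graph_def graph.simps by blast
    then show ?thesis by simp
  qed
  ultimately show ?thesis by (simp add: finite_simple_graph_def)
qed

lemma finite_simple_graph_complement:
  assumes "finite_simple_graph G"
  shows "finite_simple_graph (complement G)"
proof -
  have "e \<subseteq> verts G \<and> card e = 2" if "e \<in> edges (complement G)" for e
  proof -
    obtain a b where "e = {a, b}" "a \<in> verts G" "b \<in> verts G" "a \<noteq> b"
      using \<open>e \<in> edges (complement G)\<close> unfolding complement_def by auto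
    then show ?thesis by simp
  qed
  then show ?thesis
    using assms by (simp add: finite_simple_graph_def complement_def)
qed

text \<open>Every finite simple graph has a total colouring, so the \<open>LEAST\<close> in
  \<^const>\<open>total_chromatic_number\<close> is attained.\<close>

lemma total_colouring_exists:
  assumes "finite_simple_graph G"
  shows "\<exists>k f g. total_colouring G k f g"
proof -
  have fin: "finite (verts G)" and E: "\<And>e. e \<in> edges G \<Longrightarrow> e \<subseteq> verts G \<and> card e = 2"
    using assms by (auto simp: finite_simple_graph_def)
  have "edges G \<subseteq> Pow (verts G)" using E by blast
  then have finE: "finite (edges G)" by (rule finite_subset) (simp add: fin)
  obtain f :: "'a \<Rightarrow> nat" and n where f: "f ` verts G = {i. i < n}" "inj_on f (verts G)"
    using finite_imp_inj_to_nat_seg[OF fin] by blast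
  obtain g :: "'a set \<Rightarrow> nat" and m where g: "g ` edges G = {i. i < m}" "inj_on g (edges G)"
    using finite_imp_inj_to_nat_seg[OF finE] by blast
  have ne: "u \<noteq> v" if "{u, v} \<in> edges G" for u v
    using E[OF that] by auto
  have fb: "f v < n" if "v \<in> verts G" for v using f(1) imageI[OF that, of f] by simp
  have gb: "g e < m" if "e \<in> edges G" for e using g(1) imageI[OF that, of g] by simp
  have "total_colouring G (n + m) f (\<lambda>e. n + g e)"
    unfolding total_colouring_def
  proof (intro conjI ballI impI)
    show "f ` verts G \<subseteq> {..<n + m}" using fb trans_less_add1 by blast
    show "(\<lambda>e. n + g e) ` edges G \<subseteq> {..<n + m}" using gb by auto
    show "f u \<noteq> f v" if "u \<in> verts G" "v \<in> verts G" "{u, v} \<in> edges G" for u v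
      using that(1,2) ne[OF that(3)] inj_on_eq_iff[OF f(2)] by blast
    show "n + g e \<noteq> n + g e'"
      if "e \<in> edges G" "e' \<in> edges G" "e \<noteq> e' \<and> e \<inter> e' \<noteq> {}" for e e'
      using that(3) inj_on_eq_iff[OF g(2) that(1,2)] by simp
    show "f v \<noteq> n + g e" if "v \<in> verts G" "e \<in> edges G" "v \<in> e" for v e
      using fb[OF that(1)] by simp
  qed
  then show ?thesis by (intro exI)
qed

lemma total_colouring_total_chromatic_number:
  assumes "finite_simple_graph G"
  shows "\<exists>f g. total_colouring G (total_chromatic_number G) f g"
  unfolding total_chromatic_number_def
  by (rule LeastI_ex) (rule total_colouring_exists[OF assms])

end

theory Submission
  imports Defs "HOL-Combinatorics.Transposition"
begin

text \<open>For an element \<open>v\<close> of the poset let \<open>A v\<close> be the set of atoms below \<open>v\<close>.  The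
  only common lower bound of two elements is zero iff their atom sets are disjoint, so
  \<open>G(P)\<close> is a disjointness graph of nonempty proper subsets of the set of atoms, and its complement
  is an intersection graph.  Unless the graph is null, every singleton occurs among these subsets.  As \<open>\<chi>'' \<ge> \<Delta> + 1\<close> for every graph, a total colouring with \<open>\<Delta> + 2\<close>
  colours has to be found in both cases.

  \<^bold>\<open>The graph \<open>G(P)\<close>.\<close>  The vertices above an atom \<open>p\<close> form an independent set.  If \<open>p\<close>
  is chosen such that this set is smallest, then exactly \<open>\<Delta>\<close> vertices lie outside it, since \<open>p\<close> is adjacent
  to all of these.  Every graph with an independent set of size \<open>|V| - \<Delta>\<close> has a total colouring with \<open>\<Delta> + 2\<close>
  colours (\<open>total_colouring_of_independent_set\<close>): one colour is spent on the independent set and on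
  a maximal matching of the rest, and an apex vertex turns the remaining task into an edge
  colouring with \<open>\<Delta> + 1\<close> colours of a graph whose vertices of degree \<open>\<Delta> + 1\<close> are pairwise nonadjacent.
  Such an edge colouring exists by a refinement of Vizing's theorem
  (\<open>edge_colouring_independent_core\<close>), proved by Schrijver's method of balancing missing colours
  with Kempe switches.

  \<^bold>\<open>The complement.\<close>  0-distributivity provides for each atom \<open>p\<close> a vertex that lies above all other
  atoms but not above \<open>p\<close> (\<open>upper_bound_avoiding_atom\<close>).  If \<open>m\<close> vertices have the atom set
  \<open>{p}\<close>, that vertex has degree \<open>|V| - m - 1\<close>, so \<open>|V| - m + 1\<close> colours may be used.  Choose \<open>p\<close>
  with \<open>m\<close> smallest.  The other \<open>|V| - m\<close> vertices are coloured like a complete graph, by sums of positions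
  modulo an odd number.  A neighbour \<open>t\<close> of the \<open>m\<close> special vertices misses some atom \<open>i\<close>, so it
  is not adjacent to the at least \<open>m\<close> vertices with atom set \<open>{i}\<close>; the colours which
  the edges from \<open>t\<close> to these vertices would have had are free for its edges to the special ones.  A
  suitable order of the positions makes this consistent
  (\<open>cyclic_total_colouring\<close>, \<open>intersection_graph_total_colouring\<close>).\<close>

section \<open>Edge colourings and Kempe switches\<close>

definition proper_edge_colouring :: "'a set set \<Rightarrow> nat set \<Rightarrow> ('a set \<Rightarrow> nat) \<Rightarrow> bool" where
  "proper_edge_colouring E Q c \<longleftrightarrow> c ` E \<subseteq> Q \<and> (\<forall>v. inj_on c {e \<in> E. v \<in> e})"

definition missing :: "'a set set \<Rightarrow> nat set \<Rightarrow> ('a set \<Rightarrow> nat) \<Rightarrow> 'a \<Rightarrow> nat set" where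
  "missing E Q c v = Q - c ` {e \<in> E. v \<in> e}"

lemma other_endpoint:
  assumes "card e = 2" "v \<in> e"
  obtains u where "e = {u, v}" "u \<noteq> v"
proof -
  obtain a b where "e = {a, b}" "a \<noteq> b" using assms(1) by (meson card_2_iff)
  then show thesis using that[of a] that[of b] assms(2) by (auto simp: insert_commute)
qed

definition adjacency :: "'a set set \<Rightarrow> 'a rel" where
  "adjacency E = {(a, b). {a, b} \<in> E}"

lemma sym_adjacency: "sym (adjacency E)"
  by (auto simp: sym_def adjacency_def insert_commute)

text \<open>A connected graph on \<open>n\<close> vertices has at least \<open>n - 1\<close> edges: each vertex other than
  \<open>x\<close> is sent to the last edge of a shortest path from \<open>x\<close>, and this map is injective because
  distances from \<open>x\<close> increase along that edge.\<close>

lemma card_component_le: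
  fixes E :: "'a set set" and x :: 'a
  assumes "finite E"
  defines "D \<equiv> (adjacency E)\<^sup>* `` {x}"
  shows "finite D" "card D \<le> card {e \<in> E. e \<subseteq> D} + 1"
proof -
  let ?R = "adjacency E"
  define dist where "dist y = (LEAST n. (x, y) \<in> ?R ^^ n)" for y
  have "\<exists>p. {p, y} \<in> E \<and> p \<in> D \<and> dist p < dist y" if "y \<in> D - {x}" for y
  proof -
    from that have "(x, y) \<in> ?R\<^sup>*" by (auto simp: D_def)
    then have "\<exists>n. (x, y) \<in> ?R ^^ n" by (simp add: rtrancl_power)
    then have d: "(x, y) \<in> ?R ^^ dist y" unfolding dist_def by (rule LeastI_ex)
    then obtain n where n: "dist y = Suc n" using \<open>y \<in> D - {x}\<close> by (cases "dist y") auto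
    with d obtain p where p: "(x, p) \<in> ?R ^^ n" "(p, y) \<in> ?R" by auto
    have "dist p \<le> n" unfolding dist_def by (rule Least_le) (rule p)
    moreover have "p \<in> D" using p(1) by (auto simp: D_def rtrancl_power)
    ultimately show ?thesis using p(2) n by (auto simp: adjacency_def)
  qed
  then obtain p where p: "\<And>y. y \<in> D - {x} \<Longrightarrow> {p y, y} \<in> E \<and> p y \<in> D \<and> dist (p y) < dist y"
    by metis
  have inj: "inj_on (\<lambda>y. {p y, y}) (D - {x})"
  proof (rule inj_onI)
    fix y y' assume y: "y \<in> D - {x}" and y': "y' \<in> D - {x}" and eq: "{p y, y} = {p y', y'}"
    show "y = y'"
    proof (rule ccontr)
      assume "y \<noteq> y'"
      then have "p y = y'" "p y' = y" using eq by (auto simp: doubleton_eq_iff)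
      then show False using p[OF y] p[OF y'] by simp
    qed
  qed
  have sub: "(\<lambda>y. {p y, y}) ` (D - {x}) \<subseteq> {e \<in> E. e \<subseteq> D}" using p by auto
  have fin: "finite {e \<in> E. e \<subseteq> D}" using assms(1) by simp
  have "finite (D - {x})" using inj_on_finite[OF inj sub fin] .
  then show "finite D" by simp
  have "card (D - {x}) \<le> card {e \<in> E. e \<subseteq> D}" using card_inj_on_le[OF inj sub fin] .
  moreover have "x \<in> D" by (simp add: D_def)
  ultimately show "card D \<le> card {e \<in> E. e \<subseteq> D} + 1"
    using \<open>finite D\<close> by (simp add: card_Diff_singleton)
qed

text \<open>The two colour classes \<open>i\<close> and \<open>j\<close> are matchings.  In a component \<open>D\<close> of their union, the
  number of times that a vertex misses one of the two colours is therefore at most \<open>2 |D|\<close> minus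
  twice the number of edges inside \<open>D\<close>.  As \<open>D\<close> is connected it has at least \<open>|D| - 1\<close> edges, which
  bounds that number by two.  Counting in this way avoids any discussion of Kempe chains as paths
  and cycles.\<close>

lemma card_missing_component_le:
  fixes x :: 'a
  assumes fin: "finite E" and two: "\<And>e. e \<in> E \<Longrightarrow> card e = 2"
    and col: "proper_edge_colouring E Q c" and ij: "i \<noteq> j"
  defines "D \<equiv> (adjacency {e \<in> E. c e \<in> {i, j}})\<^sup>* `` {x}"
  shows "finite D"
    "card {v \<in> D. i \<in> missing E Q c v} + card {v \<in> D. j \<in> missing E Q c v} \<le> 2"
    "\<And>e. e \<in> E \<Longrightarrow> c e \<in> {i, j} \<Longrightarrow> e \<inter> D \<noteq> {} \<Longrightarrow> e \<subseteq> D"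
proof -
  let ?K = "{e \<in> E. c e \<in> {i, j}}"
  have finK: "finite ?K" using fin by simp
  show finD: "finite D" unfolding D_def by (rule card_component_le[OF finK])
  have D: "card D \<le> card {e \<in> ?K. e \<subseteq> D} + 1" unfolding D_def by (rule card_component_le[OF finK])
  show closed: "e \<subseteq> D" if "e \<in> E" "c e \<in> {i, j}" "e \<inter> D \<noteq> {}" for e
  proof -
    obtain a b where e: "e = {a, b}" using two[OF \<open>e \<in> E\<close>] by (auto simp: card_2_iff)
    have "(a, b) \<in> adjacency ?K" "(b, a) \<in> adjacency ?K"
      using that(1,2) by (auto simp: adjacency_def e insert_commute)
    moreover have "(x, b) \<in> (adjacency ?K)\<^sup>*" if "(x, a) \<in> (adjacency ?K)\<^sup>*" "(a, b) \<in> adjacency ?K" for a b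
      using that by (rule rtrancl_into_rtrancl)
    ultimately show ?thesis using that(3) unfolding D_def e by blast
  qed
  have count: "card {v \<in> D. k \<in> missing E Q c v} + 2 * card {e \<in> E. c e = k \<and> e \<subseteq> D} \<le> card D"
    if "k \<in> {i, j}" for k
  proof -
    let ?E = "{e \<in> E. c e = k \<and> e \<subseteq> D}"
    have "card (\<Union>?E) = (\<Sum>e\<in>?E. card e)"
    proof (rule card_Union_disjoint)
      show "pairwise disjnt ?E"
      proof (rule pairwiseI)
        fix e e' assume e: "e \<in> ?E" "e' \<in> ?E" "e \<noteq> e'"
        have "v \<notin> e'" if "v \<in> e" for v
        proof
          assume "v \<in> e'"
          have "inj_on c {e \<in> E. v \<in> e}" using col by (simp add: proper_edge_colouring_def)
          then show False using e that \<open>v \<in> e'\<close> by (auto dest: inj_onD)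
        qed
        then show "disjnt e e'" by (auto simp: disjnt_def)
      qed
      show "finite e" if "e \<in> ?E" for e
        using two[of e] that by (auto intro: card_ge_0_finite)
    qed
    also have "\<dots> = 2 * card ?E" using two by simp
    finally have "card (\<Union>?E) = 2 * card ?E" .
    moreover have "card ({v \<in> D. k \<in> missing E Q c v} \<union> \<Union>?E) \<le> card D"
      by (rule card_mono) (use finD in auto)
    moreover have "card ({v \<in> D. k \<in> missing E Q c v} \<union> \<Union>?E)
        = card {v \<in> D. k \<in> missing E Q c v} + card (\<Union>?E)"
      by (rule card_Un_disjoint) (use finD in \<open>auto simp: missing_def intro: finite_subset[of _ D]\<close>)
    ultimately show ?thesis by simp
  qed
  have "{e \<in> ?K. e \<subseteq> D} = {e \<in> E. c e = i \<and> e \<subseteq> D} \<union> {e \<in> E. c e = j \<and> e \<subseteq> D}" by auto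
  moreover have "card ({e \<in> E. c e = i \<and> e \<subseteq> D} \<union> {e \<in> E. c e = j \<and> e \<subseteq> D})
      = card {e \<in> E. c e = i \<and> e \<subseteq> D} + card {e \<in> E. c e = j \<and> e \<subseteq> D}"
    by (rule card_Un_disjoint) (use fin ij in auto)
  ultimately show "card {v \<in> D. i \<in> missing E Q c v} + card {v \<in> D. j \<in> missing E Q c v} \<le> 2"
    using count[of i] count[of j] D by simp
qed

text \<open>Since no edge of colour \<open>i\<close> or \<open>j\<close> leaves \<open>D\<close>, every vertex sees on all its edges
  either the old colours or the transposed ones, according to whether it lies in \<open>D\<close>.\<close>

lemma Kempe_switch:
  fixes c :: "'a set \<Rightarrow> nat"
  assumes col: "proper_edge_colouring E Q c" and ij: "i \<in> Q" "j \<in> Q"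
    and closed: "\<And>e. e \<in> E \<Longrightarrow> c e \<in> {i, j} \<Longrightarrow> e \<inter> D \<noteq> {} \<Longrightarrow> e \<subseteq> D"
  defines "c' \<equiv> \<lambda>e. if e \<subseteq> D then transpose i j (c e) else c e"
  shows "proper_edge_colouring E Q c'"
    "missing E Q c' v = (if v \<in> D then transpose i j ` missing E Q c v else missing E Q c v)"
proof -
  have in_D: "c' e = transpose i j (c e)" if "e \<in> E" "v \<in> e" "v \<in> D" for e v
    using closed[OF that(1)] that by (cases "c e \<in> {i, j}") (auto simp: c'_def)
  have out_D: "c' e = c e" if "v \<in> e" "v \<notin> D" for e v
    using that by (auto simp: c'_def)
  have im_Q: "transpose i j ` Q = Q" using ij by (simp add: transpose_image_eq)
  have inj: "inj_on c {e \<in> E. v \<in> e}" for v using col by (simp add: proper_edge_colouring_def)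
  have "inj_on c' {e \<in> E. v \<in> e}" for v
  proof (cases "v \<in> D")
    case True
    have "inj_on (transpose i j \<circ> c) {e \<in> E. v \<in> e}"
      by (rule comp_inj_on[OF inj]) simp
    then show ?thesis by (rule inj_on_cong[THEN iffD1, rotated]) (use in_D True in auto)
  next
    case False
    show ?thesis by (rule inj_on_cong[THEN iffD1, OF _ inj]) (use out_D False in auto)
  qed
  moreover have "c' e \<in> Q" if "e \<in> E" for e
  proof -
    have "c e \<in> Q" using col that by (auto simp: proper_edge_colouring_def)
    then show ?thesis using im_Q by (auto simp: c'_def)
  qed
  ultimately show "proper_edge_colouring E Q c'" by (auto simp: proper_edge_colouring_def)
  show "missing E Q c' v = (if v \<in> D then transpose i j ` missing E Q c v else missing E Q c v)"
  proof (cases "v \<in> D")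
    case True
    have "c' ` {e \<in> E. v \<in> e} = transpose i j ` c ` {e \<in> E. v \<in> e}"
      unfolding image_image by (rule image_cong) (use in_D True in auto)
    then show ?thesis using True im_Q
      by (simp add: missing_def image_set_diff[OF inj_on_transpose])
  next
    case False
    have "c' ` {e \<in> E. v \<in> e} = c ` {e \<in> E. v \<in> e}"
      by (rule image_cong) (use out_D False in auto)
    then show ?thesis using False by (simp add: missing_def)
  qed
qed

section \<open>Edge colourings of graphs whose core is independent\<close>

text \<open>If \<open>Z\<close> had at least as many elements as \<open>X\<close> in every component, then summing over the
  components would give \<open>|X| \<le> |Z|\<close>.\<close>

lemma component_with_surplus:
  fixes N :: "'a set" and R :: "'a rel"
  assumes "finite N" "X \<subseteq> N" "Z \<subseteq> N" "card Z < card X" "sym R"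
  obtains x where "card (Z \<inter> R\<^sup>* `` {x}) < card (X \<inter> R\<^sup>* `` {x})"
proof -
  define cls where "cls x = R\<^sup>* `` {x}" for x
  have cls: "cls x = cls y \<longleftrightarrow> y \<in> cls x" for x y
    unfolding cls_def using sym_rtrancl[OF \<open>sym R\<close>] by (auto dest: symD intro: rtrancl_trans)
  define h :: "'a \<Rightarrow> int" where "h x = of_bool (x \<in> X) - of_bool (x \<in> Z)" for x
  have sum_h: "sum h (N \<inter> S) = int (card (X \<inter> S)) - int (card (Z \<inter> S))" for S
  proof -
    have "(\<Sum>x\<in>N \<inter> S. of_bool (x \<in> A) :: int) = int (card (A \<inter> S))" if "A \<subseteq> N" for A
    proof -
      have "A \<inter> S = {x \<in> N \<inter> S. x \<in> A}" using that by auto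
      then show ?thesis using \<open>finite N\<close> by (simp add: of_bool_def sum.If_cases Int_def conj_ac)
    qed
    then show ?thesis unfolding h_def sum_subtractf using assms by simp
  qed
  have "sum h N > 0" using sum_h[of UNIV] assms(4) by simp
  moreover have "sum h N = (\<Sum>D\<in>cls ` N. sum h {x \<in> N. cls x = D})"
    by (rule sum.image_gen[OF \<open>finite N\<close>])
  ultimately have "\<exists>D\<in>cls ` N. sum h {x \<in> N. cls x = D} > 0"
    by (metis (no_types, lifting) not_less sum_nonpos)
  then obtain x where "x \<in> N" "sum h {y \<in> N. cls y = cls x} > 0" by auto
  moreover have "{y \<in> N. cls y = cls x} = N \<inter> cls x" using cls by blast
  ultimately have "card (Z \<inter> cls x) < card (X \<inter> cls x)" using sum_h[of "cls x"] by simp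
  then show thesis using that by (simp add: cls_def)
qed

text \<open>Every vertex of \<open>N\<close> reserves two of the colours that it misses, except for \<open>u0\<close>, which
  reserves one.  Exactly one odd reservation makes the total number of reservations odd.\<close>

definition palette_choice ::
    "'a set set \<Rightarrow> nat set \<Rightarrow> 'a set \<Rightarrow> 'a \<Rightarrow> ('a set \<Rightarrow> nat) \<Rightarrow> ('a \<Rightarrow> nat set) \<Rightarrow> bool" where
  "palette_choice E Q N u0 c S \<longleftrightarrow> proper_edge_colouring E Q c \<and>
     (\<forall>v\<in>N. S v \<subseteq> missing E Q c v \<and> card (S v) = (if v = u0 then 1 else 2))"

text \<open>Some Kempe component of the colours \<open>i\<close> and \<open>j\<close> contains more vertices reserving \<open>i\<close>
  than vertices reserving \<open>j\<close>, and the difference is at most two because a component misses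
  the two colours at most twice.  Switching that component moves one or two reservations from
  \<open>i\<close> to \<open>j\<close>, which brings the two class sizes closer when they differ by three or more.\<close>

lemma Kempe_rebalance:
  assumes finE: "finite E" and two: "\<And>e. e \<in> E \<Longrightarrow> card e = 2"
    and finQ: "finite Q" and finN: "finite N"
    and pc: "palette_choice E Q N u0 c S"
    and ij: "i \<in> Q" "j \<in> Q"
    and unbal: "card {v \<in> N. j \<in> S v} + 3 \<le> card {v \<in> N. i \<in> S v}"
  shows "\<exists>c' S'. palette_choice E Q N u0 c' S' \<and>
     (\<Sum>k\<in>Q. (card {v \<in> N. k \<in> S' v})\<^sup>2) < (\<Sum>k\<in>Q. (card {v \<in> N. k \<in> S v})\<^sup>2)"
proof -
  define X where "X k = {v \<in> N. k \<in> S v}" for k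
  have finX: "finite (X k)" for k using finN by (simp add: X_def)
  have col: "proper_edge_colouring E Q c"
    and SM: "\<And>v. v \<in> N \<Longrightarrow> S v \<subseteq> missing E Q c v"
    and SC: "\<And>v. v \<in> N \<Longrightarrow> card (S v) = (if v = u0 then 1 else 2)"
    using pc by (auto simp: palette_choice_def)
  have "i \<noteq> j" using unbal by auto
  obtain x where x: "card (X j \<inter> (adjacency {e \<in> E. c e \<in> {i, j}})\<^sup>* `` {x})
      < card (X i \<inter> (adjacency {e \<in> E. c e \<in> {i, j}})\<^sup>* `` {x})"
    by (rule component_with_surplus[OF finN, of "X i" "X j"])
      (use unbal sym_adjacency in \<open>auto simp: X_def\<close>)
  define D where "D = (adjacency {e \<in> E. c e \<in> {i, j}})\<^sup>* `` {x}"
  have comp: "finite D"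
    "card {v \<in> D. i \<in> missing E Q c v} + card {v \<in> D. j \<in> missing E Q c v} \<le> 2"
    unfolding D_def by (rule card_missing_component_le[OF finE _ col \<open>i \<noteq> j\<close>]; fact two)+
  have closed: "e \<subseteq> D" if "e \<in> E" "c e \<in> {i, j}" "e \<inter> D \<noteq> {}" for e
    unfolding D_def
    by (rule card_missing_component_le(3)[OF finE _ col \<open>i \<noteq> j\<close> that(1,2)])
      (fact two, fact that(3)[unfolded D_def])
  define c' where "c' = (\<lambda>e. if e \<subseteq> D then transpose i j (c e) else c e)"
  define S' where "S' v = (if v \<in> D then transpose i j ` S v else S v)" for v
  have switch: "proper_edge_colouring E Q c'"
    "missing E Q c' v = (if v \<in> D then transpose i j ` missing E Q c v else missing E Q c v)" for v
    unfolding c'_def by (rule Kempe_switch[OF col ij]; fact closed)+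
  have pc': "palette_choice E Q N u0 c' S'"
    unfolding palette_choice_def
  proof (intro conjI ballI)
    show "proper_edge_colouring E Q c'" by (rule switch(1))
    show "S' v \<subseteq> missing E Q c' v" if "v \<in> N" for v
      using SM[OF that] switch(2)[of v] by (auto simp: S'_def)
    show "card (S' v) = (if v = u0 then 1 else 2)" if "v \<in> N" for v
      using SC[OF that] by (auto simp: S'_def card_image)
  qed
  define X' where "X' k = {v \<in> N. k \<in> S' v}" for k
  define a where "a = card (X i \<inter> D)"
  define b where "b = card (X j \<inter> D)"
  have "b < a" using x by (simp add: a_def b_def D_def)
  have "a \<le> card {v \<in> D. i \<in> missing E Q c v}" unfolding a_def
    by (rule card_mono) (use comp(1) SM in \<open>auto simp: X_def\<close>)
  moreover have "b \<le> card {v \<in> D. j \<in> missing E Q c v}" unfolding b_def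
    by (rule card_mono) (use comp(1) SM in \<open>auto simp: X_def\<close>)
  ultimately have "a + b \<le> 2" using comp(2) by linarith
  have split: "card (X k) = card (X k - D) + card (X k \<inter> D)" for k
    using card_Int_Diff[OF finX, of k D] by simp
  have new: "card (X' k) = card (X k - D) + card (X (transpose i j k) \<inter> D)" for k
  proof -
    have "X' k = (X k - D) \<union> (X (transpose i j k) \<inter> D)"
      by (auto simp: X'_def X_def S'_def in_transpose_image_iff)
    then show ?thesis
      using card_Un_disjoint[of "X k - D" "X (transpose i j k) \<inter> D"] finX by auto
  qed
  have rest: "card (X' k) = card (X k)" if "k \<in> Q - {i, j}" for k
    using that new[of k] split[of k] by simp
  have i: "card (X' i) + (a - b) = card (X i)"
    using new[of i] split[of i] \<open>b < a\<close> by (simp add: a_def b_def)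
  have j: "card (X' j) = card (X j) + (a - b)"
    using new[of j] split[of j] \<open>b < a\<close> by (simp add: a_def b_def)
  have delta: "a - b = 1 \<or> a - b = 2" using \<open>b < a\<close> \<open>a + b \<le> 2\<close> by linarith
  have ineq: "(card (X' i))\<^sup>2 + (card (X' j))\<^sup>2 < (card (X i))\<^sup>2 + (card (X j))\<^sup>2"
    using delta
  proof
    assume "a - b = 1"
    then have "card (X i) = card (X' i) + 1" "card (X' j) = card (X j) + 1" using i j by auto
    then show ?thesis using unbal by (simp add: power2_eq_square X_def[symmetric])
  next
    assume "a - b = 2"
    then have "card (X i) = card (X' i) + 2" "card (X' j) = card (X j) + 2" using i j by auto
    then show ?thesis using unbal by (simp add: power2_eq_square X_def[symmetric])
  qed
  have pick: "(\<Sum>k\<in>Q. g k) = (\<Sum>k\<in>Q - {i, j}. g k) + (g i + g j)" for g :: "nat \<Rightarrow> nat"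
    using sum.subset_diff[of "{i, j}" Q g] finQ ij \<open>i \<noteq> j\<close> by simp
  have "(\<Sum>k\<in>Q. (card (X' k))\<^sup>2) < (\<Sum>k\<in>Q. (card (X k))\<^sup>2)"
    using pick[of "\<lambda>k. (card (X' k))\<^sup>2"] pick[of "\<lambda>k. (card (X k))\<^sup>2"] ineq rest by simp
  then show ?thesis using pc' unfolding X_def X'_def by blast
qed

text \<open>Take a colouring and reservations that minimise the sum of the squared class sizes.  Any two
  classes then differ in size by at most two.  The sizes add up to \<open>2 |N| - 1 < 2 |Q|\<close>, so some
  class has size at most one.  If no class had size one, then one would be empty, all would have
  size zero or two, and their sum would be even.\<close>

lemma private_missing_colour:
  fixes E :: "'a set set"
  assumes finE: "finite E" and two: "\<And>e. e \<in> E \<Longrightarrow> card e = 2"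
    and finQ: "finite Q" and finN: "finite N" and NQ: "card N \<le> card Q" and u0: "u0 \<in> N"
    and col: "proper_edge_colouring E Q c"
    and miss: "\<And>v. v \<in> N \<Longrightarrow> (if v = u0 then 1 else 2) \<le> card (missing E Q c v)"
  obtains c' S i u where "palette_choice E Q N u0 c' S" "i \<in> Q" "{v \<in> N. i \<in> S v} = {u}"
proof -
  have "\<exists>T. T \<subseteq> missing E Q c v \<and> card T = (if v = u0 then 1 else 2)" if "v \<in> N" for v
    using obtain_subset_with_card_n[OF miss[OF that]] by metis
  then obtain S0 where "\<And>v. v \<in> N \<Longrightarrow> S0 v \<subseteq> missing E Q c v \<and> card (S0 v) = (if v = u0 then 1 else 2)"
    by metis
  then have pc0: "palette_choice E Q N u0 c S0" using col by (simp add: palette_choice_def)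
  define \<Phi> where "\<Phi> = (\<lambda>(c :: 'a set \<Rightarrow> nat, S). \<Sum>k\<in>Q. (card {v \<in> N. k \<in> S v})\<^sup>2)"
  define P where "P = (\<lambda>(c, S). palette_choice E Q N u0 c S)"
  have "P (c, S0)" using pc0 by (simp add: P_def)
  then obtain cS where min: "P cS" "\<And>cS'. P cS' \<Longrightarrow> \<Phi> cS \<le> \<Phi> cS'"
    using ex_has_least_nat[of P "(c, S0)" \<Phi>] by blast
  obtain c1 S where cS: "cS = (c1, S)" by fastforce
  have pc: "palette_choice E Q N u0 c1 S" using min(1) by (simp add: P_def cS)
  define x where "x k = card {v \<in> N. k \<in> S v}" for k
  have balanced: "x i \<le> x j + 2" if ij: "i \<in> Q" "j \<in> Q" for i j
  proof (rule ccontr)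
    assume "\<not> x i \<le> x j + 2"
    then have "card {v \<in> N. j \<in> S v} + 3 \<le> card {v \<in> N. i \<in> S v}" by (simp add: x_def)
    from Kempe_rebalance[OF finE two finQ finN pc ij this]
    obtain c' S' where "P (c', S')" "\<Phi> (c', S') < \<Phi> cS" by (auto simp: P_def \<Phi>_def cS)
    then show False using min(2)[of "(c', S')"] by simp
  qed
  have S: "S v \<subseteq> Q" "card (S v) = (if v = u0 then 1 else 2)" if "v \<in> N" for v
    using pc that by (auto simp: palette_choice_def missing_def)
  have "(\<Sum>k\<in>Q. x k) = (\<Sum>k\<in>Q. \<Sum>v\<in>N. of_bool (k \<in> S v))"
    using finN by (simp add: x_def of_bool_def sum.If_cases Int_def)
  also have "\<dots> = (\<Sum>v\<in>N. \<Sum>k\<in>Q. of_bool (k \<in> S v))" by (rule sum.swap)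
  also have "\<dots> = (\<Sum>v\<in>N. card (S v))"
  proof (rule sum.cong[OF refl])
    fix v assume "v \<in> N"
    have "{k \<in> Q. k \<in> S v} = S v" using S(1)[OF \<open>v \<in> N\<close>] by auto
    then show "(\<Sum>k\<in>Q. of_bool (k \<in> S v)) = card (S v)"
      using finQ by (simp add: of_bool_def sum.If_cases Int_def)
  qed
  also have "\<dots> = (\<Sum>v\<in>N - {u0}. card (S v)) + 1"
    using sum.remove[OF finN u0, of "\<lambda>v. card (S v)"] S(2)[OF u0] by simp
  also have "(\<Sum>v\<in>N - {u0}. card (S v)) = 2 * (card N - 1)"
    using S(2) finN u0 by simp
  finally have total: "(\<Sum>k\<in>Q. x k) = 2 * (card N - 1) + 1" .
  have "\<exists>i\<in>Q. x i = 1"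
  proof (rule ccontr)
    assume none: "\<not> (\<exists>i\<in>Q. x i = 1)"
    have "\<exists>j\<in>Q. x j < 2"
    proof (rule ccontr)
      assume "\<not> (\<exists>j\<in>Q. x j < 2)"
      then have "2 * card Q \<le> (\<Sum>k\<in>Q. x k)"
        using sum_mono[of Q "\<lambda>_. 2" x] by (force simp: not_less)
      moreover have "card N > 0" using u0 finN by (auto simp: card_gt_0_iff)
      ultimately show False using total NQ by linarith
    qed
    then obtain j where "j \<in> Q" "x j < 2" by blast
    then have "x j \<noteq> 1" using none by blast
    with \<open>x j < 2\<close> have "x j = 0" by linarith
    then have "x k \<le> 2" if "k \<in> Q" for k using balanced[OF that \<open>j \<in> Q\<close>] by simp
    moreover have "x k \<noteq> 1" if "k \<in> Q" for k using none that by blast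
    ultimately have "x k = 0 \<or> x k = 2" if "k \<in> Q" for k using that by (force simp: le_less less_2_cases_iff)
    then have "even (x k)" if "k \<in> Q" for k using that by fastforce
    then have "even (\<Sum>k\<in>Q. x k)" by (simp add: dvd_sum)
    then show False using total by simp
  qed
  then obtain i u where "i \<in> Q" "{v \<in> N. i \<in> S v} = {u}"
    by (auto simp: x_def card_1_singleton_iff)
  then show thesis using that pc by blast
qed

text \<open>This is the induction in Schrijver's proof of Vizing's theorem.  The set \<open>N\<close> consists of the
  neighbours of a vertex yet to be added, and \<open>f v\<close> is the colour of the new edge at \<open>v\<close>.  A
  colour \<open>i\<close> reserved by a single vertex \<open>u\<close> is given to the new edge at \<open>u\<close>; then
  \<open>u\<close>, the colour \<open>i\<close> and all its edges are set aside.  The remaining vertices keep their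
  reservations, so the induction hypothesis applies with one colour less.\<close>

lemma extend_colouring_to_new_vertex:
  fixes E :: "'a set set"
  assumes "finite E" and "\<And>e. e \<in> E \<Longrightarrow> card e = 2"
    and "finite Q" and "finite N" and "card N \<le> card Q"
    and "proper_edge_colouring E Q c"
    and "\<And>v. v \<in> N \<Longrightarrow> (if v = u0 then 1 else 2) \<le> card (missing E Q c v)"
  shows "\<exists>c' f. proper_edge_colouring E Q c' \<and> inj_on f N \<and> (\<forall>v\<in>N. f v \<in> missing E Q c' v)"
  using assms
proof (induction "card N" arbitrary: E Q N c u0)
  case 0
  then show ?case by (intro exI[of _ c]) auto
next
  case (Suc n)
  have "N \<noteq> {}" using Suc.hyps(2) by auto
  then obtain u1 where u1: "u1 \<in> N" "u0 \<in> N \<longrightarrow> u1 = u0" by (cases "u0 \<in> N") auto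
  have "(if v = u1 then 1 else 2) \<le> card (missing E Q c v)" if "v \<in> N" for v
    using Suc.prems(7)[OF that] u1 that by (auto split: if_splits)
  then obtain c1 S i u where pc: "palette_choice E Q N u1 c1 S" "i \<in> Q" and u: "{v \<in> N. i \<in> S v} = {u}"
    using private_missing_colour[OF Suc.prems(1-5) u1(1) Suc.prems(6)] by blast
  have col: "proper_edge_colouring E Q c1" and S: "\<And>v. v \<in> N \<Longrightarrow> S v \<subseteq> missing E Q c1 v"
    and card_S: "\<And>v. v \<in> N \<Longrightarrow> card (S v) = (if v = u1 then 1 else 2)"
    using pc by (auto simp: palette_choice_def)
  have "u \<in> N" "i \<in> S u" using u by auto
  define E' where "E' = {e \<in> E. c1 e \<noteq> i}"
  define Q' where "Q' = Q - {i}"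
  define N' where "N' = N - {u}"
  have "proper_edge_colouring E' Q' c1"
    using col by (auto simp: proper_edge_colouring_def E'_def Q'_def inj_on_def)
  moreover have "(if v = u1 then 1 else 2) \<le> card (missing E' Q' c1 v)" if "v \<in> N'" for v
  proof -
    have "v \<in> N" "i \<notin> S v" using that u by (auto simp: N'_def)
    then have "S v \<subseteq> missing E' Q' c1 v" using S[of v] by (auto simp: missing_def E'_def Q'_def)
    moreover have "finite (missing E' Q' c1 v)" using \<open>finite Q\<close> by (simp add: missing_def Q'_def)
    ultimately show ?thesis using card_mono card_S[OF \<open>v \<in> N\<close>] by metis
  qed
  moreover have "n = card N'" "card N' \<le> card Q'"
    using Suc.hyps(2) Suc.prems(4,5) \<open>u \<in> N\<close> \<open>i \<in> Q\<close> \<open>finite Q\<close> by (auto simp: N'_def Q'_def)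
  ultimately obtain c2 f where c2: "proper_edge_colouring E' Q' c2" "inj_on f N'"
      "\<And>v. v \<in> N' \<Longrightarrow> f v \<in> missing E' Q' c2 v"
    using Suc.hyps(1)[of N' E' Q' c1 u1] Suc.prems(1-4) by (auto simp: E'_def Q'_def N'_def)
  define c' where "c' e = (if c1 e = i then i else c2 e)" for e
  define f' where "f' = f(u := i)"
  have c2Q: "c2 e \<in> Q" "c2 e \<noteq> i" if "e \<in> E" "c1 e \<noteq> i" for e
    using c2(1) that by (auto simp: proper_edge_colouring_def E'_def Q'_def)
  have "proper_edge_colouring E Q c'"
    unfolding proper_edge_colouring_def
  proof (intro conjI allI inj_onI)
    show "c' ` E \<subseteq> Q" using c2Q \<open>i \<in> Q\<close> by (auto simp: c'_def)
    fix v e e' assume e: "e \<in> {e \<in> E. v \<in> e}" "e' \<in> {e \<in> E. v \<in> e}" and eq: "c' e = c' e'"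
    have inj: "inj_on c1 {e \<in> E. v \<in> e}" "inj_on c2 {e \<in> E'. v \<in> e}"
      using col c2(1) by (auto simp: proper_edge_colouring_def)
    show "e = e'"
    proof (cases "c1 e = i")
      case True
      then have "c1 e' = i" using eq c2Q(2)[of e'] e by (auto simp: c'_def split: if_splits)
      then show ?thesis using True inj_onD[OF inj(1) _ e] by simp
    next
      case False
      then have "c1 e' \<noteq> i" using eq c2Q(2)[of e] e by (auto simp: c'_def split: if_splits)
      then have "c2 e = c2 e'" "e \<in> {e \<in> E'. v \<in> e}" "e' \<in> {e \<in> E'. v \<in> e}"
        using False eq e by (auto simp: c'_def E'_def)
      then show ?thesis using inj_onD[OF inj(2)] by blast
    qed
  qed
  moreover have fi: "f v \<in> Q" "f v \<noteq> i" "\<And>e. e \<in> E' \<Longrightarrow> v \<in> e \<Longrightarrow> c2 e \<noteq> f v" if "v \<in> N'" for v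
    using c2(3)[OF that] unfolding missing_def Q'_def by (blast, blast, metis (mono_tags, lifting) DiffE image_eqI mem_Collect_eq)
  have "inj_on f' N"
  proof -
    have "N = insert u N'" "u \<notin> N'" using \<open>u \<in> N\<close> by (auto simp: N'_def)
    moreover have "i \<notin> f ` N'" using fi(2) by auto
    ultimately show ?thesis using c2(2) by (auto simp: f'_def inj_on_def)
  qed
  moreover have "f' v \<in> missing E Q c' v" if "v \<in> N" for v
  proof (cases "v = u")
    case True
    have "c1 e \<noteq> i" if "e \<in> E" "u \<in> e" for e
      using S[OF \<open>u \<in> N\<close>] \<open>i \<in> S u\<close> that by (auto simp: missing_def)
    then show ?thesis using True \<open>i \<in> Q\<close> c2Q(2) by (auto simp: missing_def f'_def c'_def)
  next
    case False
    then have "v \<in> N'" using that by (simp add: N'_def)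
    then have "c' e \<noteq> f v" if "e \<in> E" "v \<in> e" for e
      using fi[of v] that by (auto simp: c'_def E'_def)
    then have "f v \<notin> c' ` {e \<in> E. v \<in> e}" by fastforce
    then show ?thesis using False fi(1)[OF \<open>v \<in> N'\<close>] by (simp add: missing_def f'_def)
  qed
  ultimately show ?case by blast
qed

text \<open>Vizing's theorem, in the sharper form for graphs in which no two vertices of degree \<open>k\<close> are
  adjacent: already \<open>k\<close> colours suffice.  Remove a vertex \<open>v\<close>, choosing one of degree \<open>k\<close> as
  long as there is one.  Its neighbours then have degree less than \<open>k\<close>, so after the removal each of
  them misses at least two of the \<open>k\<close> colours, and the colouring of the rest extends to \<open>v\<close>.\<close>

theorem edge_colouring_independent_core:
  fixes E :: "'a set set"
  assumes "finite E" and "\<And>e. e \<in> E \<Longrightarrow> card e = 2"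
    and "\<And>v. card {e \<in> E. v \<in> e} \<le> k"
    and "\<And>e. e \<in> E \<Longrightarrow> \<exists>v\<in>e. card {e' \<in> E. v \<in> e'} < k"
  shows "\<exists>c. proper_edge_colouring E {..<k} c"
  using assms
proof (induction "card E" arbitrary: E rule: less_induct)
  case less
  note finE = less.prems(1) and two = less.prems(2) and deg = less.prems(3) and core = less.prems(4)
  show ?case
  proof (cases "E = {}")
    case True
    then show ?thesis by (intro exI[of _ "\<lambda>_. 0"]) (simp add: proper_edge_colouring_def)
  next
    case False
    have "\<exists>v. (\<exists>e\<in>E. v \<in> e) \<and> (\<forall>u. {u, v} \<in> E \<longrightarrow> card {e \<in> E. u \<in> e} < k)"
    proof (cases "\<exists>e\<in>E. \<exists>v\<in>e. card {e \<in> E. v \<in> e} = k")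
      case True
      then obtain e v where v: "e \<in> E" "v \<in> e" "card {e \<in> E. v \<in> e} = k" by blast
      have "card {e \<in> E. u \<in> e} < k" if "{u, v} \<in> E" for u using core[OF that] v(3) by auto
      then show ?thesis using v by blast
    next
      case False
      obtain e where "e \<in> E" using \<open>E \<noteq> {}\<close> by blast
      moreover obtain v where "v \<in> e" using two[OF \<open>e \<in> E\<close>] by fastforce
      moreover have "card {e \<in> E. u \<in> e} < k" if "{u, v} \<in> E" for u
        using False that deg[of u] by (metis insertI1 le_neq_implies_less)
      ultimately show ?thesis by blast
    qed
    then obtain v where v: "\<exists>e\<in>E. v \<in> e" and nb: "\<And>u. {u, v} \<in> E \<Longrightarrow> card {e \<in> E. u \<in> e} < k"
      by blast
    define E' where "E' = {e \<in> E. v \<notin> e}"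
    define N where "N = {u. {u, v} \<in> E}"
    have sub: "{e \<in> E'. u \<in> e} \<subseteq> {e \<in> E. u \<in> e}" for u by (auto simp: E'_def)
    have card_sub: "card {e \<in> E'. u \<in> e} \<le> card {e \<in> E. u \<in> e}" for u
      by (rule card_mono[OF _ sub]) (use finE in simp)
    have "E' \<subset> E" using v by (auto simp: E'_def)
    then have "card E' < card E" using finE by (rule psubset_card_mono[rotated])
    moreover have "\<exists>u\<in>e. card {e' \<in> E'. u \<in> e'} < k" if "e \<in> E'" for e
      using core[of e] that card_sub by (auto simp: E'_def intro: le_less_trans)
    moreover have "card {e \<in> E'. u \<in> e} \<le> k" for u using card_sub deg le_trans by blast
    ultimately have "\<exists>c. proper_edge_colouring E' {..<k} c"
      using less.hyps[of E'] finE two by (simp add: E'_def)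
    then obtain c where c: "proper_edge_colouring E' {..<k} c" by blast
    have edge_v: "\<exists>u. u \<in> N \<and> e = {u, v} \<and> u \<noteq> v" if "e \<in> E" "v \<in> e" for e
    proof -
      obtain u where "e = {u, v}" "u \<noteq> v" using other_endpoint[OF two[OF \<open>e \<in> E\<close>] \<open>v \<in> e\<close>] .
      then show ?thesis using \<open>e \<in> E\<close> by (auto simp: N_def)
    qed
    have loopless: "u \<noteq> v" if "u \<in> N" for u using two[of "{u, v}"] that by (auto simp: N_def)
    have star: "{e \<in> E. v \<in> e} = (\<lambda>u. {u, v}) ` N"
    proof
      show "{e \<in> E. v \<in> e} \<subseteq> (\<lambda>u. {u, v}) ` N" using edge_v by blast
      show "(\<lambda>u. {u, v}) ` N \<subseteq> {e \<in> E. v \<in> e}" by (auto simp: N_def)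
    qed
    have inj_star: "inj_on (\<lambda>u. {u, v}) N" by (auto simp: inj_on_def doubleton_eq_iff)
    have finN: "finite N"
      by (rule finite_imageD[OF _ inj_star]) (simp add: star[symmetric] finE)
    have cardN: "card N \<le> k" using deg[of v] card_image[OF inj_star] star by simp
    have "2 \<le> card (missing E' {..<k} c u)" if "u \<in> N" for u
    proof -
      have "{u, v} \<in> {e \<in> E. u \<in> e} - {e \<in> E'. u \<in> e}" using that by (auto simp: N_def E'_def)
      then have "card {e \<in> E'. u \<in> e} < card {e \<in> E. u \<in> e}"
        using sub[of u] finE by (intro psubset_card_mono) auto
      moreover have "card {e \<in> E. u \<in> e} < k" using nb that by (simp add: N_def)
      moreover have "card (c ` {e \<in> E'. u \<in> e}) \<le> card {e \<in> E'. u \<in> e}"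
        by (rule card_image_le) (use finE in \<open>simp add: E'_def\<close>)
      moreover have "card {..<k} - card (c ` {e \<in> E'. u \<in> e}) \<le> card (missing E' {..<k} c u)"
        unfolding missing_def by (rule diff_card_le_card_Diff) (use finE in \<open>simp add: E'_def\<close>)
      ultimately show ?thesis by simp
    qed
    then have miss: "(if u = v then 1 else 2) \<le> card (missing E' {..<k} c u)" if "u \<in> N" for u
      using that by fastforce
    have "\<exists>c' f. proper_edge_colouring E' {..<k} c' \<and> inj_on f N \<and> (\<forall>u\<in>N. f u \<in> missing E' {..<k} c' u)"
    proof (rule extend_colouring_to_new_vertex)
      show "finite E'" "finite {..<k}" "finite N" "card N \<le> card {..<k}" "proper_edge_colouring E' {..<k} c"
        using finE finN cardN c by (simp_all add: E'_def)
      show "card e = 2" if "e \<in> E'" for e using two that by (simp add: E'_def)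
    qed (fact miss)
    then obtain c' f where c': "proper_edge_colouring E' {..<k} c'" and f: "inj_on f N"
        "\<And>u. u \<in> N \<Longrightarrow> f u \<in> missing E' {..<k} c' u" by blast
    define c'' where "c'' e = (if v \<in> e then f (the_elem (e - {v})) else c' e)" for e
    have c''_star: "c'' {u, v} = f u" if "u \<in> N" for u
    proof -
      have "{u, v} - {v} = {u}" using loopless[OF that] by auto
      then show ?thesis by (simp add: c''_def)
    qed
    have "proper_edge_colouring E {..<k} c''"
      unfolding proper_edge_colouring_def
    proof (intro conjI allI)
      show "c'' ` E \<subseteq> {..<k}"
      proof (rule image_subsetI)
        fix e assume "e \<in> E"
        show "c'' e \<in> {..<k}"
        proof (cases "v \<in> e")
          case True
          then obtain u where "u \<in> N" "e = {u, v}" using edge_v[OF \<open>e \<in> E\<close>] by blast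
          then show ?thesis using c''_star f(2)[of u] by (simp add: missing_def)
        next
          case False
          then show ?thesis using c' \<open>e \<in> E\<close> by (auto simp: c''_def E'_def proper_edge_colouring_def)
        qed
      qed
      fix w
      show "inj_on c'' {e \<in> E. w \<in> e}"
      proof (cases "w = v")
        case True
        have "inj_on (c'' \<circ> (\<lambda>u. {u, v})) N"
          using f(1) c''_star by (simp add: inj_on_def)
        then show ?thesis unfolding True star by (rule inj_on_imageI)
      next
        case False
        have "inj_on c' {e \<in> E'. w \<in> e}" using c' by (simp add: proper_edge_colouring_def)
        then have inj: "inj_on c'' {e \<in> E'. w \<in> e}"
          by (rule inj_on_cong[THEN iffD1, rotated]) (auto simp: c''_def E'_def)
        show ?thesis
        proof (cases "w \<in> N")
          case True
          have "e = {w, v}" if "e \<in> E" "w \<in> e" "v \<in> e" for e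
            using edge_v[OF that(1,3)] that(2) False by auto
          then have "{e \<in> E. w \<in> e} \<subseteq> insert {w, v} {e \<in> E'. w \<in> e}"
            unfolding E'_def by (intro subsetI) (simp, metis)
          moreover have "insert {w, v} {e \<in> E'. w \<in> e} \<subseteq> {e \<in> E. w \<in> e}"
            using True by (auto simp: E'_def N_def)
          ultimately have eq: "{e \<in> E. w \<in> e} = insert {w, v} {e \<in> E'. w \<in> e}" by (rule equalityI)
          have "c'' ` {e \<in> E'. w \<in> e} = c' ` {e \<in> E'. w \<in> e}"
            by (rule image_cong) (auto simp: c''_def E'_def)
          then have "c'' {w, v} \<notin> c'' ` {e \<in> E'. w \<in> e}"
            using c''_star[OF True] f(2)[OF True] by (simp add: missing_def)
          then have "inj_on c'' (insert {w, v} {e \<in> E'. w \<in> e})" using inj unfolding inj_on_insert by blast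
          then show ?thesis unfolding eq .
        next
          case False
          have "v \<notin> e" if "e \<in> E" "w \<in> e" for e
            using edge_v[OF that(1)] that(2) False \<open>w \<noteq> v\<close> by auto
          then have "{e \<in> E. w \<in> e} = {e \<in> E'. w \<in> e}" by (auto simp: E'_def)
          then show ?thesis using inj by simp
        qed
      qed
    qed
    then show ?thesis by blast
  qed
qed

section \<open>Total colourings of graphs with a large independent set\<close>

lemma finite_edges:
  assumes "finite_simple_graph G"
  shows "finite (edges G)"
proof (rule finite_subset)
  show "edges G \<subseteq> Pow (verts G)" using assms by (auto simp: finite_simple_graph_def)
  show "finite (Pow (verts G))" using assms by (simp add: finite_simple_graph_def)
qed

lemma degree_eq_card_neighbours:
  assumes "finite_simple_graph G"
  shows "degree G v = card {u \<in> verts G. {u, v} \<in> edges G}"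
proof -
  let ?N = "{u \<in> verts G. {u, v} \<in> edges G}"
  have edge: "e \<subseteq> verts G" "card e = 2" if "e \<in> edges G" for e
    using assms that by (auto simp: finite_simple_graph_def)
  have "{e \<in> edges G. v \<in> e} = (\<lambda>u. {u, v}) ` ?N"
  proof
    show "(\<lambda>u. {u, v}) ` ?N \<subseteq> {e \<in> edges G. v \<in> e}" by auto
    show "{e \<in> edges G. v \<in> e} \<subseteq> (\<lambda>u. {u, v}) ` ?N"
    proof
      fix e assume e: "e \<in> {e \<in> edges G. v \<in> e}"
      then have "e \<in> edges G" "v \<in> e" by auto
      then obtain u where u: "e = {u, v}" using other_endpoint[OF edge(2)] by metis
      then have "u \<in> ?N" using edge(1)[OF \<open>e \<in> edges G\<close>] \<open>e \<in> edges G\<close> by simp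
      then show "e \<in> (\<lambda>u. {u, v}) ` ?N" using u by (intro image_eqI)
    qed
  qed
  moreover have "inj_on (\<lambda>u. {u, v}) ?N" by (auto simp: inj_on_def doubleton_eq_iff)
  ultimately show ?thesis by (simp add: degree_def card_image)
qed

text \<open>The lower bound \<open>\<Delta> + 1\<close> always holds, since a vertex of maximum degree and its edges
  all need different colours.  Hence only the upper bound has to be established for a given graph.\<close>

lemma satisfies_TCC_if_total_colouring:
  assumes G: "finite_simple_graph G"
    and col: "total_colouring G k f g" and v: "v \<in> verts G" "k \<le> degree G v + 2"
  shows "satisfies_TCC G"
proof -
  have fin: "finite (verts G)" using G by (simp add: finite_simple_graph_def)
  have le_max: "degree G u \<le> max_degree G" if "u \<in> verts G" for u
    unfolding max_degree_def using fin that by simp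
  have "total_chromatic_number G \<le> k"
    unfolding total_chromatic_number_def by (rule Least_le) (use col in blast)
  also have "k \<le> max_degree G + 2" using v le_max[OF v(1)] by simp
  finally have upper: "total_chromatic_number G \<le> max_degree G + 2" .
  have "max_degree G \<in> degree G ` verts G"
    unfolding max_degree_def by (rule Max_in) (use fin v in auto)
  then obtain w where w: "w \<in> verts G" "max_degree G = degree G w" by blast
  obtain f g where fg: "total_colouring G (total_chromatic_number G) f g"
    using total_colouring_total_chromatic_number[OF G] by blast
  let ?S = "{e \<in> edges G. w \<in> e}"
  have finS: "finite ?S" using finite_edges[OF G] by simp
  have "inj_on g ?S" using fg unfolding total_colouring_def inj_on_def by blast
  then have "card (insert (f w) (g ` ?S)) = degree G w + 1"
    using fg w(1) finS by (subst card_insert_disjoint) (auto simp: total_colouring_def card_image degree_def)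
  moreover have "card (insert (f w) (g ` ?S)) \<le> card {..<total_chromatic_number G}"
    by (rule card_mono) (use fg w(1) in \<open>auto simp: total_colouring_def\<close>)
  ultimately have "max_degree G + 1 \<le> total_chromatic_number G" using w(2) by simp
  then show ?thesis using upper unfolding satisfies_TCC_def by linarith
qed

lemma maximal_matching_exists:
  assumes "finite E"
  obtains F where "F \<subseteq> E" "pairwise disjnt F" "\<And>e. e \<in> E \<Longrightarrow> e \<noteq> {} \<Longrightarrow> e \<inter> \<Union>F \<noteq> {}"
proof -
  let ?M = "{F. F \<subseteq> E \<and> pairwise disjnt F}"
  have "finite ?M" using assms by simp
  moreover have "{} \<in> ?M" by simp
  ultimately have "\<exists>F\<in>?M. {} \<subseteq> F \<and> (\<forall>F'\<in>?M. F \<subseteq> F' \<longrightarrow> F = F')"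
    by (rule finite_has_maximal2)
  then obtain F where F: "F \<in> ?M" and max: "\<forall>F'\<in>?M. F \<subseteq> F' \<longrightarrow> F = F'"
    by (elim bexE conjE)
  have "e \<inter> \<Union>F \<noteq> {}" if "e \<in> E" "e \<noteq> {}" for e
  proof
    assume e: "e \<inter> \<Union>F = {}"
    have "disjnt e e'" "disjnt e' e" if "e' \<in> F" for e' using e that unfolding disjnt_def by blast+
    then have "insert e F \<in> ?M" using F \<open>e \<in> E\<close> by (simp add: pairwise_insert)
    then have "insert e F \<subseteq> F" using max by (metis order_refl subset_insertI)
    then show False using e \<open>e \<noteq> {}\<close> by blast
  qed
  moreover have "F \<subseteq> E" "pairwise disjnt F" using F by auto
  ultimately show thesis using that[of F] by simp
qed

text \<open>The graph with a new vertex \<^term>\<open>None\<close> joined to all of \<open>Y\<close>.  The colour of an edge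
  at the apex will serve as the colour of its other endpoint.\<close>

definition apex_edges :: "'a set set \<Rightarrow> 'a set \<Rightarrow> 'a option set set" where
  "apex_edges E Y = (`) Some ` E \<union> (\<lambda>y. {None, Some y}) ` Y"

text \<open>Let \<open>Y\<close> be the complement of the independent set \<open>X\<close>.  The last colour is used for all of
  \<open>X\<close> and for a maximal matching \<open>F\<close> inside \<open>Y\<close>.  What remains is to colour the
  edges outside \<open>F\<close> and the vertices of \<open>Y\<close> with \<open>d + 1\<close> colours, that is, to
  edge-colour the graph obtained by deleting \<open>F\<close> and joining an apex to \<open>Y\<close>.  A vertex of
  degree \<open>d + 1\<close> in that graph lies in \<open>Y\<close> and is not covered by \<open>F\<close>; by maximality of
  \<open>F\<close> no two such vertices are adjacent, so the core is independent.\<close>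

lemma total_colouring_of_independent_set:
  assumes G: "finite_simple_graph G" and X: "X \<subseteq> verts G"
    and indep: "\<And>e. e \<in> edges G \<Longrightarrow> \<not> e \<subseteq> X"
    and deg: "\<And>v. v \<in> verts G \<Longrightarrow> degree G v \<le> d"
    and card_Y: "card (verts G - X) \<le> d"
  shows "\<exists>f g. total_colouring G (d + 2) f g"
proof -
  have finV: "finite (verts G)" and edge: "\<And>e. e \<in> edges G \<Longrightarrow> e \<subseteq> verts G"
    "\<And>e. e \<in> edges G \<Longrightarrow> card e = 2" using G by (auto simp: finite_simple_graph_def)
  have finE: "finite (edges G)" by (rule finite_edges[OF G])
  define Y where "Y = verts G - X"
  have finY: "finite Y" using finV by (simp add: Y_def)
  obtain F where F: "F \<subseteq> {e \<in> edges G. e \<subseteq> Y}" "pairwise disjnt F"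
    and F_max: "\<And>e. e \<in> {e \<in> edges G. e \<subseteq> Y} \<Longrightarrow> e \<noteq> {} \<Longrightarrow> e \<inter> \<Union>F \<noteq> {}"
    by (rule maximal_matching_exists[of "{e \<in> edges G. e \<subseteq> Y}"]) (use finE in auto)
  define H where "H = edges G - F"
  define E where "E = apex_edges H Y"
  have finH: "finite H" using finE by (simp add: H_def)
  have finE': "finite E" using finH finY by (simp add: E_def apex_edges_def)
  have two: "card e = 2" if "e \<in> E" for e
    using that edge(2) by (auto simp: E_def apex_edges_def card_image H_def)
  have deg_H: "card {e \<in> H. v \<in> e} \<le> d" for v
  proof (cases "v \<in> verts G")
    case True
    have "card {e \<in> H. v \<in> e} \<le> degree G v" unfolding degree_def
      by (rule card_mono) (use finE in \<open>auto simp: H_def\<close>)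
    then show ?thesis using deg[OF True] by simp
  next
    case False
    then have "{e \<in> H. v \<in> e} = {}" using edge(1) by (auto simp: H_def)
    then show ?thesis by (simp only: card.empty)
  qed
  have deg_H_matched: "card {e \<in> H. v \<in> e} < d" if "v \<in> \<Union>F" for v
  proof -
    obtain e where e: "e \<in> F" "v \<in> e" using \<open>v \<in> \<Union>F\<close> by blast
    then have "e \<in> edges G" using F(1) by blast
    then have v: "v \<in> verts G" using edge(1) e(2) by blast
    have "card {e \<in> H. v \<in> e} < degree G v" unfolding degree_def
      by (rule psubset_card_mono) (use finE e \<open>e \<in> edges G\<close> in \<open>auto simp: H_def\<close>)
    then show ?thesis using deg[OF v] by simp
  qed
  have deg_Some: "card {e \<in> E. Some v \<in> e} \<le> card {e \<in> H. v \<in> e} + (if v \<in> Y then 1 else 0)" for v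
  proof -
    have "{e \<in> E. Some v \<in> e} \<subseteq> (`) Some ` {e \<in> H. v \<in> e} \<union> (if v \<in> Y then {{None, Some v}} else {})"
      by (auto simp: E_def apex_edges_def)
    then have "card {e \<in> E. Some v \<in> e}
        \<le> card ((`) Some ` {e \<in> H. v \<in> e} \<union> (if v \<in> Y then {{None, Some v}} else {}))"
      by (rule card_mono[rotated]) (use finH in simp)
    also have "\<dots> \<le> card ((`) Some ` {e \<in> H. v \<in> e}) + card (if v \<in> Y then {{None, Some v}} else {})"
      by (rule card_Un_le)
    also have "\<dots> \<le> card {e \<in> H. v \<in> e} + (if v \<in> Y then 1 else 0)"
      using card_image_le[of "{e \<in> H. v \<in> e}" "(`) Some"] finH by simp
    finally show ?thesis .
  qed
  have deg_None: "card {e \<in> E. None \<in> e} \<le> d"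
  proof -
    have "{e \<in> E. None \<in> e} \<subseteq> (\<lambda>y. {None, Some y}) ` Y" by (auto simp: E_def apex_edges_def)
    then have "card {e \<in> E. None \<in> e} \<le> card ((\<lambda>y. {None, Some y}) ` Y)"
      by (rule card_mono[rotated]) (use finY in simp)
    also have "\<dots> \<le> d" using card_image_le[OF finY] card_Y Y_def le_trans by blast
    finally show ?thesis .
  qed
  have "\<exists>c. proper_edge_colouring E {..<d + 1} c"
  proof (rule edge_colouring_independent_core[OF finE' two])
    show "card {e \<in> E. w \<in> e} \<le> d + 1" for w
    proof (cases w)
      case None
      then show ?thesis using deg_None by simp
    next
      case (Some v)
      then show ?thesis using deg_Some[of v] deg_H[of v] by (simp split: if_splits)
    qed
    fix e assume "e \<in> E"
    then consider (apex) "None \<in> e" | (old) e0 where "e0 \<in> H" "e = Some ` e0"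
      by (auto simp: E_def apex_edges_def)
    then show "\<exists>w\<in>e. card {e' \<in> E. w \<in> e'} < d + 1"
    proof cases
      case apex
      then show ?thesis using deg_None by (intro bexI[of _ None]) auto
    next
      case old
      have e0: "e0 \<in> edges G" "e0 \<notin> F" using old by (auto simp: H_def)
      have "\<exists>v\<in>e0. card {e' \<in> E. Some v \<in> e'} < d + 1"
      proof (cases "e0 \<subseteq> Y")
        case True
        have "e0 \<noteq> {}" using edge(2)[OF e0(1)] by auto
        then obtain v where "v \<in> e0" "v \<in> \<Union>F" using F_max[of e0] e0(1) True by blast
        then show ?thesis using deg_Some[of v] deg_H_matched[of v]
          by (intro bexI[of _ v]) (simp_all split: if_splits)
      next
        case False
        then obtain v where "v \<in> e0" "v \<notin> Y" by blast
        then show ?thesis using deg_Some[of v] deg_H[of v] by (intro bexI[of _ v]) simp_all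
      qed
      then show ?thesis using old by auto
    qed
  qed
  then obtain c where c: "c ` E \<subseteq> {..<d + 1}" "\<And>w. inj_on c {e \<in> E. w \<in> e}"
    by (auto simp: proper_edge_colouring_def)
  define f where "f v = (if v \<in> X then d + 1 else c {None, Some v})" for v
  define g where "g e = (if e \<in> F then d + 1 else c (Some ` e))" for e
  have H_E: "Some ` e \<in> E" if "e \<in> edges G" "e \<notin> F" for e
    using that by (auto simp: E_def apex_edges_def H_def)
  have Y_E: "{None, Some v} \<in> E" if "v \<in> verts G" "v \<notin> X" for v
    using that by (auto simp: E_def apex_edges_def Y_def)
  have cE: "c e < d + 1" if "e \<in> E" for e using c(1) that by blast
  have apart: "c e \<noteq> c e'" if "e \<in> E" "e' \<in> E" "w \<in> e" "w \<in> e'" "e \<noteq> e'" for e e' w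
    using inj_onD[OF c(2)[of w], of e e'] that by blast
  have "total_colouring G (d + 2) f g"
    unfolding total_colouring_def
  proof (intro conjI ballI impI)
    show "f ` verts G \<subseteq> {..<d + 2}" using cE[OF Y_E] by (force simp: f_def)
    show "g ` edges G \<subseteq> {..<d + 2}" using cE[OF H_E] by (force simp: g_def)
    show "f u \<noteq> f v" if "u \<in> verts G" "v \<in> verts G" "{u, v} \<in> edges G" for u v
    proof -
      have "u \<noteq> v" using edge(2)[OF that(3)] by auto
      moreover have "u \<notin> X \<or> v \<notin> X" using indep[OF that(3)] by blast
      moreover have "c {None, Some u} \<noteq> c {None, Some v}" if "u \<notin> X" "v \<notin> X"
        by (rule apart[of _ _ None]) (use Y_E that \<open>u \<in> verts G\<close> \<open>v \<in> verts G\<close> \<open>u \<noteq> v\<close> in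
          \<open>auto simp: doubleton_eq_iff\<close>)
      ultimately show ?thesis 
        using cE[OF Y_E[OF that(1)]] cE[OF Y_E[OF that(2)]] by (auto simp: f_def)
    qed
    show "g e \<noteq> g e'" if e: "e \<in> edges G" "e' \<in> edges G" "e \<noteq> e' \<and> e \<inter> e' \<noteq> {}" for e e'
    proof -
      obtain w where w: "w \<in> e" "w \<in> e'" using e(3) by blast
      have "\<not> (e \<in> F \<and> e' \<in> F)" using F(2) e(3) by (auto simp: pairwise_def disjnt_def)
      moreover have "c (Some ` e) \<noteq> c (Some ` e')" if "e \<notin> F" "e' \<notin> F"
        by (rule apart[of _ _ "Some w"])
          (use H_E that e w in \<open>auto simp: inj_image_eq_iff\<close>)
      ultimately show ?thesis 
        using cE[OF H_E[OF e(1)]] cE[OF H_E[OF e(2)]] by (auto simp: g_def)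
    qed
    show "f v \<noteq> g e" if v: "v \<in> verts G" "e \<in> edges G" "v \<in> e" for v e
    proof -
      have "v \<notin> X" if "e \<in> F" using F(1) that v by (auto simp: Y_def)
      moreover have "c {None, Some v} \<noteq> c (Some ` e)" if "v \<notin> X" "e \<notin> F"
        by (rule apart[of _ _ "Some v"]) (use Y_E H_E that v in auto)
      ultimately show ?thesis 
        using cE[OF H_E[OF v(2)]] cE[OF Y_E[OF v(1)]] by (auto simp: f_def g_def)
    qed
  qed
  then show ?thesis by blast
qed

section \<open>Total colourings by sums modulo an odd number\<close>

lemma mod_eq_window:
  fixes a b l q :: nat
  assumes "a mod q = b mod q" "l \<le> a" "a < l + q" "l \<le> b" "b < l + q"
  shows "a = b"
proof -
  have "\<bar>int a - int b\<bar> < int q" using assms(2-5) by linarith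
  moreover have "int q dvd int a - int b"
    using assms(1) by (metis mod_eq_dvd_iff of_nat_mod)
  ultimately have "int a - int b = 0" using zdvd_imp_le[of "int q" "\<bar>int a - int b\<bar>"] by fastforce
  then show ?thesis by simp
qed

lemma add_mod_left_cancel:
  fixes a b c q :: nat
  shows "(c + a) mod q = (c + b) mod q \<longleftrightarrow> a mod q = b mod q"
  by (simp add: nat_mod_eq_iff)

lemma double_mod_eq:
  fixes a b q :: nat
  assumes "odd q" "a < q" "b < q" "(2 * a) mod q = (2 * b) mod q"
  shows "a = b"
proof -
  have "int q dvd int (2 * a) - int (2 * b)"
    using assms(4) by (metis mod_eq_dvd_iff of_nat_mod)
  then have "int q dvd 2 * (int a - int b)" by (simp add: algebra_simps)
  moreover have "coprime (int q) 2" using assms(1) by simp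
  ultimately have "int q dvd int a - int b" using coprime_dvd_mult_right_iff by blast
  then have "a mod q = b mod q" by (metis mod_eq_dvd_iff of_nat_eq_iff of_nat_mod)
  then show ?thesis using assms(2,3) by simp
qed

lemma monotone_numbering:
  fixes key :: "'a \<Rightarrow> nat"
  assumes "finite S"
  obtains pos where "bij_betw pos S {..<card S}"
    "\<And>a b. a \<in> S \<Longrightarrow> b \<in> S \<Longrightarrow> key a < key b \<Longrightarrow> pos a < pos b"
proof -
  have "\<exists>pos. bij_betw pos S {..<card S} \<and> (\<forall>a\<in>S. \<forall>b\<in>S. key a < key b \<longrightarrow> pos a < pos b)"
    using assms
  proof (induction "card S" arbitrary: S)
    case 0
    then show ?case by (auto simp: bij_betw_def)
  next
    case (Suc n)
    have "Max (key ` S) \<in> key ` S" by (rule Max_in) (use Suc in auto)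
    then obtain m where "m \<in> S" "key m = Max (key ` S)" by auto
    then have m: "m \<in> S" "\<And>a. a \<in> S \<Longrightarrow> key a \<le> key m" using Suc.prems by auto
    have cardS: "card (S - {m}) = n" using Suc.hyps(2) Suc.prems m(1) by simp
    obtain pos where pos: "bij_betw pos (S - {m}) {..<n}"
        "\<forall>a\<in>S - {m}. \<forall>b\<in>S - {m}. key a < key b \<longrightarrow> pos a < pos b"
      using Suc.hyps(1)[of "S - {m}"] Suc.prems cardS by auto
    define pos' where "pos' = pos(m := n)"
    have "bij_betw pos' (S - {m}) {..<n}"
      using pos(1) by (subst bij_betw_cong[of _ _ pos]) (auto simp: pos'_def)
    then have "bij_betw pos' (insert m (S - {m})) (insert (pos' m) {..<n})"
      by (intro notIn_Un_bij_betw[of m _ pos' "{..<n}", simplified]) (auto simp: pos'_def)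
    moreover have "insert m (S - {m}) = S" "insert (pos' m) {..<n} = {..<Suc n}"
      using m(1) by (auto simp: pos'_def)
    ultimately have "bij_betw pos' S {..<card S}" using Suc.hyps(2) by simp
    moreover have "pos' a < pos' b" if ab: "a \<in> S" "b \<in> S" "key a < key b" for a b
    proof -
      have "a \<noteq> m" using m(2)[OF ab(2)] ab(3) by auto
      then have "pos a < n" using bij_betw_apply[OF pos(1), of a] ab(1) by simp
      then show ?thesis using pos(2) ab \<open>a \<noteq> m\<close> by (auto simp: pos'_def)
    qed
    ultimately show ?case by blast
  qed
  then show thesis using that by blast
qed

text \<open>Applied to \<open>k\<close> and \<open>k + 1\<close>, this says that the elements with key \<open>k\<close> occupy an interval
  of positions.\<close>

lemma monotone_numbering_block:
  fixes key :: "'a \<Rightarrow> nat"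
  assumes fin: "finite S" and bij: "bij_betw pos S {..<card S}"
    and mono: "\<And>a b. a \<in> S \<Longrightarrow> b \<in> S \<Longrightarrow> key a < key b \<Longrightarrow> pos a < pos b"
    and w: "w \<in> S"
  shows "key w < k \<longleftrightarrow> pos w < card {a \<in> S. key a < k}"
proof -
  have inj: "inj_on pos S" and im: "pos ` S = {..<card S}" using bij by (auto simp: bij_betw_def)
  let ?L = "{a \<in> S. key a < k}"
  have finL: "finite ?L" using fin by simp
  have injL: "inj_on pos ?L" using inj by (rule inj_on_subset) auto
  show ?thesis
  proof
    assume "key w < k"
    have "{..pos w} \<subseteq> pos ` ?L"
    proof
      fix n assume "n \<in> {..pos w}"
      moreover have "pos w < card S" using im w by blast
      ultimately have "n \<in> pos ` S" unfolding im by simp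
      then obtain a where a: "a \<in> S" "n = pos a" by blast
      have "\<not> key w < key a" using mono[OF w a(1)] \<open>n \<in> {..pos w}\<close> a(2) by auto
      then show "n \<in> pos ` ?L" using a \<open>key w < k\<close> by auto
    qed
    then have "card {..pos w} \<le> card (pos ` ?L)" by (rule card_mono[rotated]) (use finL in simp)
    then show "pos w < card ?L" using card_image[OF injL] by simp
  next
    assume "pos w < card ?L"
    show "key w < k"
    proof (rule ccontr)
      assume "\<not> key w < k"
      then have "pos ` ?L \<subseteq> {..<pos w}" using mono w by fastforce
      then have "card (pos ` ?L) \<le> card {..<pos w}" by (rule card_mono[rotated]) simp
      then show False using card_image[OF injL] \<open>pos w < card ?L\<close> by simp
    qed
  qed
qed

lemma total_colouring_mono:
  assumes "total_colouring G k f g" "k \<le> k'"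
  shows "total_colouring G k' f g"
proof -
  have "{..<k} \<subseteq> {..<k'}" using assms(2) by auto
  moreover have "f ` verts G \<subseteq> {..<k}" "g ` edges G \<subseteq> {..<k}"
    using assms(1) by (simp_all add: total_colouring_def)
  ultimately have "f ` verts G \<subseteq> {..<k'}" "g ` edges G \<subseteq> {..<k'}" by (meson order_trans)+
  then show ?thesis using assms(1) by (simp add: total_colouring_def)
qed

text \<open>The complete graph is coloured by such a table when the table is a symmetric Latin square
  with distinct diagonal entries; for other graphs, row \<open>v\<close> has to be injective only on \<open>v\<close> and its neighbours.\<close>

lemma total_colouring_of_symmetric_table:
  fixes c :: "'a \<Rightarrow> 'a \<Rightarrow> nat"
  assumes G: "finite_simple_graph G"
    and sym: "\<And>u v. c u v = c v u" and bound: "\<And>u v. c u v < k"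
    and star: "\<And>v. v \<in> verts G \<Longrightarrow> inj_on (c v) (insert v {u. {u, v} \<in> edges G})"
    and diag: "\<And>u v. {u, v} \<in> edges G \<Longrightarrow> c u u \<noteq> c v v"
  shows "\<exists>f g. total_colouring G k f g"
proof -
  have edge: "e \<subseteq> verts G" "card e = 2" if "e \<in> edges G" for e
    using G that by (auto simp: finite_simple_graph_def)
  define g where "g e = (THE n. \<exists>u v. e = {u, v} \<and> n = c u v)" for e
  have g: "g {u, v} = c u v" for u v
    unfolding g_def using sym by (intro the_equality) (auto simp: doubleton_eq_iff)
  have g_at: "\<exists>u. e = {u, v} \<and> u \<noteq> v \<and> g e = c v u" if "e \<in> edges G" "v \<in> e" for e v
  proof -
    obtain u where "e = {u, v}" "u \<noteq> v"
      using other_endpoint[OF edge(2)[OF \<open>e \<in> edges G\<close>] \<open>v \<in> e\<close>] .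
    moreover have "g {u, v} = c v u" unfolding g by (rule sym)
    ultimately show ?thesis by blast
  qed
  have "total_colouring G k (\<lambda>v. c v v) g"
    unfolding total_colouring_def
  proof (intro conjI ballI impI)
    show "(\<lambda>v. c v v) ` verts G \<subseteq> {..<k}" using bound by auto
    show "g ` edges G \<subseteq> {..<k}"
    proof (rule image_subsetI)
      fix e assume e: "e \<in> edges G"
      then have "e \<noteq> {}" using edge(2) by fastforce
      then obtain v where "v \<in> e" by blast
      then obtain u where "g e = c v u" using g_at[OF e] by blast
      then show "g e \<in> {..<k}" using bound by simp
    qed
    show "c u u \<noteq> c v v" if "{u, v} \<in> edges G" for u v using diag[OF that] .
    show "g e \<noteq> g e'" if e: "e \<in> edges G" "e' \<in> edges G" "e \<noteq> e' \<and> e \<inter> e' \<noteq> {}" for e e'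
    proof -
      obtain v where v: "v \<in> e" "v \<in> e'" using e(3) by blast
      obtain u where u: "e = {u, v}" "g e = c v u" using g_at[OF e(1) v(1)] by blast
      obtain w where w: "e' = {w, v}" "g e' = c v w" using g_at[OF e(2) v(2)] by blast
      have "u \<noteq> w" using e(3) u w by blast
      moreover have "v \<in> verts G" using edge(1)[OF e(1)] v(1) by blast
      moreover have "u \<in> insert v {u. {u, v} \<in> edges G}" "w \<in> insert v {u. {u, v} \<in> edges G}"
        using e(1,2) unfolding u(1) w(1) by blast+
      ultimately show ?thesis using inj_on_eq_iff[OF star] u(2) w(2) by metis
    qed
    show "c v v \<noteq> g e" if v: "v \<in> verts G" "e \<in> edges G" "v \<in> e" for v e
    proof -
      obtain u where u: "e = {u, v}" "u \<noteq> v" "g e = c v u" using g_at[OF v(2,3)] by blast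
      have "u \<in> insert v {u. {u, v} \<in> edges G}" "v \<in> insert v {u. {u, v} \<in> edges G}"
        using v(2) unfolding u(1) by blast+
      then show ?thesis using inj_on_eq_iff[OF star[OF v(1)]] u(2,3) by metis
    qed
  qed
  then show ?thesis by blast
qed

text \<open>The vertices of \<open>W\<close> are coloured as in the standard total colouring of a complete graph of
  odd order: edges by sums of positions modulo \<open>q\<close>, vertices by doubled positions.  The vertices of
  \<open>X\<close> reuse these colours.  The edge from \<open>x\<close> to \<open>t\<close> is coloured as if \<open>x\<close> stood at
  position \<open>b t + idx x\<close>, which is harmless at \<open>t\<close> if no neighbour of \<open>t\<close> stands there.
  At \<open>x\<close> the colours \<open>pos t + b t + idx x\<close> are distinct because they differ by less than
  \<open>q\<close> before reduction.  Inside \<open>X\<close> the vertices act as if they stood at the positions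
  \<open>s, \<dots>, s + m - 1\<close>: their mutual edges get the colours \<open>2 s + idx x + idx y\<close>, where
  \<open>2 s + idx y\<close> differs modulo \<open>q\<close> from all the sums \<open>pos t + b t\<close>, and their own colours are those of
  positions not taken by any vertex of \<open>T\<close>.\<close>

lemma cyclic_total_colouring:
  fixes pos idx b :: "'a \<Rightarrow> nat"
  assumes G: "finite_simple_graph G" and V: "verts G = X \<union> W" "X \<inter> W = {}"
    and q: "odd q" and pos: "inj_on pos W" "\<And>w. w \<in> W \<Longrightarrow> pos w < q"
    and idx: "inj_on idx X" "\<And>x. x \<in> X \<Longrightarrow> idx x < m"
    and TW: "T \<subseteq> W" and nbT: "\<And>x w. x \<in> X \<Longrightarrow> w \<in> W \<Longrightarrow> {x, w} \<in> edges G \<Longrightarrow> w \<in> T"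
    and free: "\<And>t w j. t \<in> T \<Longrightarrow> w \<in> W \<Longrightarrow> w = t \<or> {w, t} \<in> edges G \<Longrightarrow> j < m \<Longrightarrow> pos w \<noteq> b t + j"
    and bq: "\<And>t. t \<in> T \<Longrightarrow> b t + m \<le> q"
    and inj: "inj_on (\<lambda>t. pos t + b t) T"
    and window: "\<And>t. t \<in> T \<Longrightarrow> lo \<le> pos t + b t \<and> pos t + b t < 2 * s" "lo \<le> 2 * s" "2 * s + m \<le> lo + q"
    and Ts: "\<And>t. t \<in> T \<Longrightarrow> pos t < s" and sq: "s + m \<le> q"
  shows "\<exists>f g. total_colouring G q f g"
proof -
  have edge: "u \<in> verts G" "v \<in> verts G" "u \<noteq> v" if "{u, v} \<in> edges G" for u v
  proof -
    have "{u, v} \<subseteq> verts G" "card {u, v} = 2"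
      using G that by (auto simp only: finite_simple_graph_def)
    then show "u \<in> verts G" "v \<in> verts G" "u \<noteq> v" by auto
  qed
  have "q > 0" using q by (rule odd_pos)
  define kX where "kX a = (if a \<in> X then 2 * s + idx a else pos a + b a)" for a
  define kW where "kW v a = (if a \<in> X then b v + idx a else pos a)" for v a
  define c where "c v a = (if v \<in> X then idx v + kX a else pos v + kW v a) mod q" for v a
  show ?thesis
  proof (rule total_colouring_of_symmetric_table[OF G])
    show "c u v = c v u" for u v by (simp add: c_def kX_def kW_def ac_simps)
    show "c u v < q" for u v using \<open>q > 0\<close> by (simp add: c_def)
    show "inj_on (c v) (insert v {u. {u, v} \<in> edges G})" if "v \<in> verts G" for v
    proof (rule inj_onI)
      let ?N = "insert v {u. {u, v} \<in> edges G}"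
      fix a a' assume a: "a \<in> ?N" "a' \<in> ?N" and eq: "c v a = c v a'"
      show "a = a'"
      proof (cases "v \<in> X")
        case True
        \<comment> \<open>All colours at \<open>v\<close> are \<open>idx v + kX a\<close>, with \<open>kX a\<close> in a window of length \<open>q\<close>.\<close>
        have N: "a \<in> X \<union> T" if "a \<in> ?N" for a
          using that True edge[of a v] nbT[of v a] V by (auto simp: insert_commute)
        have range: "lo \<le> kX a \<and> kX a < lo + q" if "a \<in> X \<union> T" for a
          using that window(1)[of a] window(2,3) idx(2)[of a] by (auto simp: kX_def)
        have "kX a mod q = kX a' mod q" using eq True by (simp add: c_def add_mod_left_cancel)
        then have "kX a = kX a'" using range[OF N[OF a(1)]] range[OF N[OF a(2)]] mod_eq_window by blast
        moreover have "\<not> (kX x = kX t)" if "x \<in> X" "t \<in> T" for x t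
          using window(1)[OF that(2)] that V(2) TW by (auto simp: kX_def)
        moreover have "a = a'" if "a \<in> X" "a' \<in> X" "kX a = kX a'"
          using inj_onD[OF idx(1) _ that(1,2)] that by (simp add: kX_def)
        moreover have "a = a'" if "a \<in> T" "a' \<in> T" "kX a = kX a'"
        proof -
          have "a \<notin> X" "a' \<notin> X" using that(1,2) TW V(2) by auto
          then show ?thesis using inj_onD[OF inj _ that(1,2)] that(3) by (simp add: kX_def)
        qed
        ultimately show ?thesis using N[OF a(1)] N[OF a(2)] by (metis UnE)
      next
        case False
        then have "v \<in> W" using that V by auto
        \<comment> \<open>All colours at \<open>v\<close> are \<open>pos v + kW v a\<close>, with \<open>kW v a < q\<close>.\<close>
        have N: "a \<in> X \<and> v \<in> T \<or> a \<in> W \<and> (a = v \<or> {a, v} \<in> edges G)" if "a \<in> ?N" for a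
          using that \<open>v \<in> W\<close> edge[of a v] nbT[of a v] V by auto
        have range: "kW v a < q" if "a \<in> ?N" for a
          using N[OF that] bq[of v] idx(2)[of a] pos(2)[of a] V(2) by (auto simp: kW_def)
        have "kW v a mod q = kW v a' mod q" using eq False by (simp add: c_def add_mod_left_cancel)
        then have "kW v a = kW v a'" using range[OF a(1)] range[OF a(2)] by simp
        moreover have "kW v x \<noteq> kW v w" if "x \<in> X" "v \<in> T" "w \<in> W" "w = v \<or> {w, v} \<in> edges G" for x w
          using free[OF that(2-4) idx(2)[OF that(1)]] that V(2) by (auto simp: kW_def)
        moreover have "a = a'" if "a \<in> X" "a' \<in> X" "kW v a = kW v a'"
          using inj_onD[OF idx(1) _ that(1,2)] that by (simp add: kW_def)
        moreover have "a = a'" if "a \<in> W" "a' \<in> W" "kW v a = kW v a'"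
        proof -
          have "a \<notin> X" "a' \<notin> X" using that(1,2) V(2) by auto
          then show ?thesis using inj_onD[OF pos(1) _ that(1,2)] that(3) by (simp add: kW_def)
        qed
        ultimately show ?thesis using N[OF a(1)] N[OF a(2)] by metis
      qed
    qed
    show "c u u \<noteq> c v v" if e: "{u, v} \<in> edges G" for u v
    proof -
      \<comment> \<open>Every vertex gets the double of a position, and \<open>q\<close> is odd.\<close>
      define half where "half v = (if v \<in> X then s + idx v else pos v)" for v
      have c: "c v v = (2 * half v) mod q" for v
        by (simp add: c_def kX_def kW_def half_def algebra_simps mult_2_right)
      have lt: "half v < q" if "v \<in> verts G" for v
        using that V sq idx(2)[of v] pos(2)[of v] by (auto simp: half_def)
      have mixed: "half x \<noteq> half w" if "x \<in> X" "w \<in> W" "{x, w} \<in> edges G" for x w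
        using Ts[OF nbT[OF that]] that V(2) by (auto simp: half_def)
      have "half u \<noteq> half v"
      proof (cases "u \<in> X \<longleftrightarrow> v \<in> X")
        case True
        then show ?thesis using edge[OF e] V idx(1) pos(1) by (auto simp: half_def inj_on_def)
      next
        case False
        have "{v, u} \<in> edges G" using e by (simp add: insert_commute)
        then show ?thesis using False mixed[of u v] mixed[of v u] e edge[OF e] V by fastforce
      qed
      then show ?thesis using double_mod_eq[OF q lt lt] edge[OF e] unfolding c by blast
    qed
  qed
qed

section \<open>Intersection graphs of proper subsets\<close>

text \<open>Write \<open>M i\<close> for the set of vertices \<open>v\<close> with \<open>A v = {i}\<close>, and \<open>m\<close> for the size of
  \<open>M p\<close>, which is smallest.  The cyclic colouring is applied with \<open>X = M p\<close>.  The neighbours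
  of \<open>M p\<close> outside it lie in the set \<open>T\<close> of those \<open>t\<close> with \<open>p \<in> A t\<close>.  Each of them misses
  some \<open>i = miss t\<close>, hence is not adjacent to \<open>M i\<close>, and \<open>M i\<close> has at least \<open>m\<close>
  elements; so the vertices of \<open>M p\<close> may borrow the positions of the first \<open>m\<close> elements of
  \<open>M i\<close> in their edges to \<open>t\<close>.

  To keep \<open>pos t + b t\<close> injective, \<open>W\<close> is laid out in three parts: first \<open>T\<close>, sorted by the
  missed element, then the blocks \<open>M i\<close> in the same order, and last the set \<open>C\<close> of the other
  vertices \<open>v\<close> with \<open>p \<notin> A v\<close>.  Then \<open>b\<close> is monotone on \<open>T\<close>, and the sums
  \<open>pos t + b t\<close> range from \<open>|T|\<close> to less than \<open>|T| + |W| - |C| - m\<close>.  The remainder of a window of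
  length \<open>q\<close> has to hold \<open>m\<close> further values starting at an even number \<open>2 s\<close>.  Rounding up to an
  even number may cost one place, which is available because \<open>C\<close> contains \<open>h\<close> as soon as \<open>T\<close> is nonempty.\<close>

lemma intersection_graph_total_colouring:
  fixes A :: "'a \<Rightarrow> 'b set"
  assumes G: "finite_simple_graph G"
    and meet: "\<And>u v. {u, v} \<in> edges G \<Longrightarrow> A u \<inter> A v \<noteq> {}"
    and I: "finite I" "p \<in> I"
    and A: "\<And>v. v \<in> verts G \<Longrightarrow> A v \<noteq> {} \<and> A v \<subset> I"
    and min: "\<And>i. i \<in> I \<Longrightarrow> card {v \<in> verts G. A v = {p}} \<le> card {v \<in> verts G. A v = {i}}"
    and coatom: "h \<in> verts G" "A h = I - {p}"
  shows "\<exists>f g. total_colouring G (card (verts G) - card {v \<in> verts G. A v = {p}} + 1) f g"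
proof -
  define M where "M i = {v \<in> verts G. A v = {i}}" for i
  define m where "m = card (M p)"
  define W where "W = verts G - M p"
  define T where "T = {w \<in> W. p \<in> A w}"
  define C where "C = {w \<in> W. p \<notin> A w \<and> (\<nexists>i. A w = {i})}"
  have finV: "finite (verts G)" using G by (simp add: finite_simple_graph_def)
  then have finW: "finite W" and finM: "finite (M i)" for i by (simp_all add: W_def M_def)
  have TW: "T \<subseteq> W" by (auto simp: T_def)
  have cardW: "card W = card (verts G) - m"
    using finV by (simp add: W_def m_def card_Diff_subset M_def)
  have m_le: "m \<le> card (M i)" if "i \<in> I" for i
    using min[OF that] by (simp add: m_def M_def)
  have MW: "M i \<subseteq> W" if "i \<noteq> p" for i using that by (auto simp: M_def W_def)
  have "\<exists>i. i \<in> I - A t" if "t \<in> T" for t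
    using A[of t] that by (auto simp: T_def W_def)
  then obtain miss where miss: "\<And>t. t \<in> T \<Longrightarrow> miss t \<in> I - A t" by metis
  have miss_p: "miss t \<noteq> p" if "t \<in> T" for t using miss[OF that] that by (auto simp: T_def)
  obtain n and e :: "'b \<Rightarrow> nat" where e: "e ` I = {i. i < n}" "inj_on e I"
    using finite_imp_inj_to_nat_seg[OF I(1)] by blast
  have e_less: "e i < n" if "i \<in> I" for i using e(1) that by blast
  define key where "key w = (if p \<in> A w then e (miss w)
      else if \<exists>i. A w = {i} then n + e (the_elem (A w)) else 2 * n)" for w
  have key_T: "key w < n \<longleftrightarrow> w \<in> T" if "w \<in> W" for w
    using that miss e_less by (auto simp: key_def T_def)
  have key_M: "key w = n + e i \<longleftrightarrow> w \<in> M i" if "w \<in> W" "i \<in> I" "i \<noteq> p" for w i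
  proof
    assume k: "key w = n + e i"
    have "p \<notin> A w" using key_T[OF that(1)] k that(1) by (auto simp: T_def)
    then obtain i' where i': "A w = {i'}" "e i' = e i"
      using k e_less[OF \<open>i \<in> I\<close>] by (auto simp: key_def split: if_splits)
    have "w \<in> verts G" using that(1) by (simp add: W_def)
    then have "i' = i" using i' A[of w] e(2) that(2) by (auto simp: inj_on_def)
    then show "w \<in> M i" using i' \<open>w \<in> verts G\<close> by (simp add: M_def)
  next
    assume "w \<in> M i"
    then show "key w = n + e i" using that(3) by (auto simp: M_def key_def)
  qed
  have M_key: "w \<in> W \<and> key w = n + e i" if "w \<in> M i" "i \<in> I" "i \<noteq> p" for w i
    using key_M[OF _ that(2,3)] MW[OF that(3)] that(1) by blast
  obtain pos where bij: "bij_betw pos W {..<card W}"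
    and mono: "\<And>a b. a \<in> W \<Longrightarrow> b \<in> W \<Longrightarrow> key a < key b \<Longrightarrow> pos a < pos b"
    using monotone_numbering[OF finW, of key] by blast
  define below where "below k = {w \<in> W. key w < k}" for k
  have fin_below: "finite (below k)" for k using finW by (simp add: below_def)
  have block: "key w < k \<longleftrightarrow> pos w < card (below k)" if "w \<in> W" for w k
    unfolding below_def by (rule monotone_numbering_block[OF finW bij mono that])
  define b where "b t = card (below (n + e (miss t)))" for t
  have below_n: "below n = T" using key_T TW by (auto simp: below_def)
  have T_le_b: "card T \<le> b t" for t
    unfolding b_def below_n[symmetric] by (rule card_mono[OF fin_below]) (auto simp: below_def)
  have pos_T: "pos t < card T" if "t \<in> T" for t
    using block[of t n] key_T[of t] that TW by (auto simp: below_n)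
  \<comment> \<open>The positions borrowed for \<open>t\<close> are held by vertices of \<open>M (miss t)\<close>.\<close>
  have in_block: "A w = {miss t}" if "t \<in> T" "w \<in> W" "j < m" "pos w = b t + j" for t w j
  proof -
    let ?i = "miss t"
    have i: "?i \<in> I" "?i \<noteq> p" using miss miss_p that(1) by auto
    have "card (below (n + e ?i) \<union> M ?i) = b t + card (M ?i)"
      unfolding b_def by (rule card_Un_disjoint[OF fin_below finM])
        (use M_key[OF _ i] in \<open>auto simp: below_def\<close>)
    moreover have "card (below (n + e ?i) \<union> M ?i) \<le> card (below (Suc (n + e ?i)))"
      by (rule card_mono[OF fin_below]) (use M_key[OF _ i] in \<open>auto simp: below_def\<close>)
    ultimately have "pos w < card (below (Suc (n + e ?i)))" using that m_le[OF i(1)] by simp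
    then have "key w < Suc (n + e ?i)" using block[OF that(2)] by blast
    moreover have "\<not> key w < n + e ?i" using block[OF that(2)] that(4) by (simp add: b_def)
    ultimately have "w \<in> M ?i" using key_M[OF that(2) i] by simp
    then show ?thesis by (simp add: M_def)
  qed
  have b_bound: "b t + m + card C \<le> card W" if "t \<in> T" for t
  proof -
    let ?i = "miss t"
    have i: "?i \<in> I" "?i \<noteq> p" using miss miss_p that by auto
    have key_C: "key w = 2 * n" if "w \<in> C" for w using that by (auto simp: C_def key_def)
    have "card (below (n + e ?i) \<union> M ?i \<union> C) = card (below (n + e ?i) \<union> M ?i) + card C"
      by (rule card_Un_disjoint)
        (use fin_below finM finW key_C e_less[OF i(1)] in \<open>auto simp: below_def M_def C_def\<close>)
    also have "card (below (n + e ?i) \<union> M ?i) = b t + card (M ?i)"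
      unfolding b_def by (rule card_Un_disjoint[OF fin_below finM])
        (use M_key[OF _ i] in \<open>auto simp: below_def\<close>)
    finally have "b t + card (M ?i) + card C = card (below (n + e ?i) \<union> M ?i \<union> C)" by simp
    also have "\<dots> \<le> card W"
      by (rule card_mono[OF finW]) (use M_key[OF _ i] in \<open>auto simp: below_def C_def\<close>)
    finally show ?thesis using m_le[OF i(1)] by simp
  qed
  have m_W: "m \<le> card W"
  proof -
    obtain i where i: "i \<in> I" "i \<noteq> p" using A[OF coatom(1)] coatom(2) by auto
    show ?thesis using m_le[OF i(1)] card_mono[OF finW MW[OF i(2)]] by simp
  qed
  have C_ne: "card C > 0" if "t \<in> T" for t
  proof -
    have "A t \<noteq> {p}" "p \<in> A t" "A t \<subseteq> I" using that A[of t] by (auto simp: T_def W_def M_def)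
    then obtain i where "i \<in> A t" "i \<noteq> p" "i \<in> I" by blast
    then have "i \<in> A h" "miss t \<in> A h" "i \<noteq> miss t"
      using miss[OF that] miss_p[OF that] coatom(2) by auto
    then have "\<nexists>j. A h = {j}" by (metis singletonD)
    moreover from this have "h \<in> W" using coatom(1) by (simp add: W_def M_def)
    ultimately have "h \<in> C" using coatom(2) by (simp add: C_def)
    then show ?thesis using finW by (auto simp: card_gt_0_iff C_def)
  qed
  define q where "q = (if odd (card W) then card W else card W + 1)"
  have q: "odd q" "card W \<le> q" "q \<le> card W + 1" by (auto simp: q_def)
  define s where "s = (if T = {} then 0 else (card T + card W - card C - m + 1) div 2)"
  obtain idx where idx: "bij_betw idx (M p) {..<m}"
    using ex_bij_betw_finite_nat[OF finM, of p] by (auto simp: m_def atLeast0LessThan)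
  have "\<exists>f g. total_colouring G q f g"
  proof (rule cyclic_total_colouring[where X = "M p" and W = W and T = T and pos = pos
        and idx = idx and b = b and m = m and s = s and lo = "card T"])
    show "finite_simple_graph G" by (rule G)
    show "verts G = M p \<union> W" "M p \<inter> W = {}" by (auto simp: W_def M_def)
    show "odd q" by (rule q)
    show "inj_on pos W" using bij by (simp add: bij_betw_def)
    show "pos w < q" if "w \<in> W" for w using bij_betw_apply[OF bij that] q(2) by simp
    show "inj_on idx (M p)" using idx by (simp add: bij_betw_def)
    show "idx x < m" if "x \<in> M p" for x using bij_betw_apply[OF idx that] by simp
    show "T \<subseteq> W" by (rule TW)
    show "w \<in> T" if "x \<in> M p" "w \<in> W" "{x, w} \<in> edges G" for x w
      using meet[OF that(3)] that(1,2) by (auto simp: M_def T_def)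
    show "pos w \<noteq> b t + j" if "t \<in> T" "w \<in> W" "w = t \<or> {w, t} \<in> edges G" "j < m" for t w j
    proof
      assume "pos w = b t + j"
      then have "A w = {miss t}" using in_block that by blast
      then have "miss t \<in> A t" using that(3) meet[of w t] by auto
      then show False using miss[OF that(1)] by simp
    qed
    show "b t + m \<le> q" if "t \<in> T" for t using b_bound[OF that] q(2) by simp
    show "inj_on (\<lambda>t. pos t + b t) T"
    proof (rule inj_onI)
      have less: "pos t + b t < pos t' + b t'" if "t \<in> T" "t' \<in> T" "pos t < pos t'" for t t'
      proof -
        have "\<not> key t' < key t" using mono[of t' t] that TW by auto
        then have "e (miss t) \<le> e (miss t')" using that by (simp add: key_def T_def)
        then have "b t \<le> b t'" unfolding b_def
          by (intro card_mono[OF fin_below]) (auto simp: below_def)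
        then show ?thesis using that(3) by simp
      qed
      fix t t' assume t: "t \<in> T" "t' \<in> T" and eq: "pos t + b t = pos t' + b t'"
      then have "pos t = pos t'" using less[OF t] less[OF t(2,1)] by (metis less_irrefl linorder_neqE_nat)
      then show "t = t'" using bij t TW by (auto simp: bij_betw_def inj_on_def)
    qed
    have s: "card T + card W \<le> 2 * s + card C + m" "2 * s + card C + m \<le> card T + card W + 1"
      "card T \<le> s" "s + m \<le> q" if "t \<in> T" for t
    proof -
      have ne: "T \<noteq> {}" using that by blast
      have "card T + m + card C \<le> card W" using b_bound[OF that] T_le_b[of t] by simp
      moreover have "card C \<ge> 1" using C_ne[OF that] by simp
      moreover have "2 * s \<ge> card T + card W - card C - m"
        "2 * s \<le> card T + card W - card C - m + 1" using ne by (auto simp: s_def)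
      ultimately show "card T + card W \<le> 2 * s + card C + m"
        "2 * s + card C + m \<le> card T + card W + 1" "card T \<le> s" "s + m \<le> q"
        using q(2) by linarith+
    qed
    show "card T \<le> pos t + b t \<and> pos t + b t < 2 * s" if "t \<in> T" for t
      using T_le_b[of t] pos_T[OF that] b_bound[OF that] s(1)[OF that] by linarith
    show "pos t < s" if "t \<in> T" for t using pos_T[OF that] s(3)[OF that] by simp
    have "card T \<le> 2 * s \<and> 2 * s + m \<le> card T + q \<and> s + m \<le> q"
    proof (cases "T = {}")
      case True
      then show ?thesis using m_W q(2) by (simp add: s_def)
    next
      case False
      then obtain t where "t \<in> T" by blast
      then show ?thesis using s[of t] C_ne[of t] q(2) by simp
    qed
    then show "card T \<le> 2 * s" "2 * s + m \<le> card T + q" "s + m \<le> q" by auto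
  qed
  then show ?thesis using total_colouring_mono q(3) cardW by (metis M_def m_def)
qed

section \<open>Zero-divisor graphs of finite posets\<close>

locale finite_pointed_poset =
  fixes r :: "'a rel" and z :: 'a
  assumes partial_order: "Partial_order r"
    and finite_Field: "finite (Field r)"
    and least: "is_least_element r z"
begin

lemma le_refl: "a \<in> Field r \<Longrightarrow> (a, a) \<in> r"
  using partial_order by (auto simp: order_on_defs refl_on_def)

lemma le_trans: "(a, b) \<in> r \<Longrightarrow> (b, c) \<in> r \<Longrightarrow> (a, c) \<in> r"
  using partial_order by (auto simp: order_on_defs dest: transD)

lemma le_antisym: "(a, b) \<in> r \<Longrightarrow> (b, a) \<in> r \<Longrightarrow> a = b"
  using partial_order by (auto simp: order_on_defs dest: antisymD)

lemma least_in: "z \<in> Field r" and least_le: "a \<in> Field r \<Longrightarrow> (z, a) \<in> r"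
  using least by (auto simp: is_least_element_def)

definition atoms :: "'a set" where
  "atoms = {p \<in> Field r. p \<noteq> z \<and> (\<forall>x. (x, p) \<in> r \<longrightarrow> x = z \<or> x = p)}"

definition atoms_below :: "'a \<Rightarrow> 'a set" where
  "atoms_below v = {p \<in> atoms. (p, v) \<in> r}"

lemma atoms_below_subset: "atoms_below v \<subseteq> atoms"
  by (auto simp: atoms_below_def)

lemma finite_atoms: "finite atoms"
  by (rule finite_subset[OF _ finite_Field]) (auto simp: atoms_def)

lemma atoms_below_nonempty:
  assumes "v \<in> Field r" "v \<noteq> z"
  shows "atoms_below v \<noteq> {}"
  using assms
proof (induction "card {x. (x, v) \<in> r}" arbitrary: v rule: less_induct)
  case less
  show ?case
  proof (cases "v \<in> atoms")
    case True
    then show ?thesis using le_refl[OF less.prems(1)] by (auto simp: atoms_below_def)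
  next
    case False
    then obtain x where x: "(x, v) \<in> r" "x \<noteq> z" "x \<noteq> v" using less.prems by (auto simp: atoms_def)
    then have "x \<in> Field r" by (auto simp: Field_def)
    have "{y. (y, v) \<in> r} \<subseteq> Field r" by (auto simp: Field_def)
    then have "finite {y. (y, v) \<in> r}" using finite_Field by (rule finite_subset)
    moreover have "{y. (y, x) \<in> r} \<subseteq> {y. (y, v) \<in> r}" using le_trans x(1) by blast
    moreover have "v \<in> {y. (y, v) \<in> r}" "v \<notin> {y. (y, x) \<in> r}"
      using le_refl[OF less.prems(1)] le_antisym[OF x(1)] x(3) by auto
    ultimately have "card {y. (y, x) \<in> r} < card {y. (y, v) \<in> r}"
      by (intro psubset_card_mono) blast+
    then have "atoms_below x \<noteq> {}" using less.hyps \<open>x \<in> Field r\<close> x(2) by blast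
    then show ?thesis using le_trans[OF _ x(1)] by (auto simp: atoms_below_def)
  qed
qed

lemma atoms_below_atom:
  assumes "p \<in> atoms"
  shows "atoms_below p = {p}"
  using assms le_refl[of p] by (auto simp: atoms_below_def atoms_def)

text \<open>Adjacency depends only on the atoms below the two elements, because a nonzero common lower bound
  has an atom below it.\<close>

lemma Under_pair_eq_least_iff:
  assumes "a \<in> Field r" "b \<in> Field r"
  shows "Under r {a, b} = {z} \<longleftrightarrow> atoms_below a \<inter> atoms_below b = {}"
proof
  assume U: "Under r {a, b} = {z}"
  show "atoms_below a \<inter> atoms_below b = {}"
  proof (rule ccontr)
    assume "atoms_below a \<inter> atoms_below b \<noteq> {}"
    then obtain p where "p \<in> atoms" "(p, a) \<in> r" "(p, b) \<in> r" by (auto simp: atoms_below_def)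
    then have "p \<in> Under r {a, b}" "p \<noteq> z" by (auto simp: Under_def atoms_def)
    then show False using U by blast
  qed
next
  assume disj: "atoms_below a \<inter> atoms_below b = {}"
  have "x = z" if "x \<in> Under r {a, b}" for x
  proof (rule ccontr)
    assume "x \<noteq> z"
    have x: "x \<in> Field r" "(x, a) \<in> r" "(x, b) \<in> r" using that by (auto simp: Under_def)
    obtain p where "p \<in> atoms" "(p, x) \<in> r"
      using atoms_below_nonempty[OF x(1) \<open>x \<noteq> z\<close>] by (auto simp: atoms_below_def)
    then have "p \<in> atoms_below a \<inter> atoms_below b"
      using le_trans[OF _ x(2)] le_trans[OF _ x(3)] by (simp add: atoms_below_def)
    then show False using disj by blast
  qed
  moreover have "z \<in> Under r {a, b}" using least_in least_le assms by (auto simp: Under_def)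
  ultimately show "Under r {a, b} = {z}" by blast
qed

abbreviation G :: "'a graph" where
  "G \<equiv> zero_divisor_graph r z"

lemma G_simple: "finite_simple_graph G"
  by (rule finite_simple_graph_zero_divisor_graph[OF finite_Field])

lemma vertex_iff: "v \<in> verts G \<longleftrightarrow> v \<in> Field r \<and> v \<noteq> z \<and> atoms_below v \<noteq> atoms"
proof -
  have "(\<exists>b\<in>Field r - {z}. Under r {v, b} = {z}) \<longleftrightarrow> atoms_below v \<noteq> atoms" if v: "v \<in> Field r"
  proof
    assume "\<exists>b\<in>Field r - {z}. Under r {v, b} = {z}"
    then obtain b where b: "b \<in> Field r" "b \<noteq> z" "Under r {v, b} = {z}" by blast
    then have "atoms_below v \<inter> atoms_below b = {}" using Under_pair_eq_least_iff[OF v] by blast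
    then show "atoms_below v \<noteq> atoms"
      using atoms_below_nonempty[OF b(1,2)] atoms_below_subset[of b] by blast
  next
    assume "atoms_below v \<noteq> atoms"
    then obtain p where p: "p \<in> atoms" "p \<notin> atoms_below v" using atoms_below_subset[of v] by blast
    then have "p \<in> Field r - {z}" by (auto simp: atoms_def)
    moreover have "Under r {v, p} = {z}"
      using Under_pair_eq_least_iff[OF v, of p] atoms_below_atom[OF p(1)] p calculation by simp
    ultimately show "\<exists>b\<in>Field r - {z}. Under r {v, b} = {z}" by blast
  qed
  then show ?thesis by (auto simp: zero_divisor_graph_def zero_divisors_def)
qed

lemma edge_iff:
  "{u, v} \<in> edges G \<longleftrightarrow> u \<in> verts G \<and> v \<in> verts G \<and> atoms_below u \<inter> atoms_below v = {}"
proof -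
  have "{u, v} \<in> edges G \<longleftrightarrow> u \<in> verts G \<and> v \<in> verts G \<and> u \<noteq> v \<and> Under r {u, v} = {z}"
  proof
    assume "{u, v} \<in> edges G"
    then obtain a b where "{u, v} = {a, b}" "a \<in> verts G" "b \<in> verts G" "a \<noteq> b" "Under r {a, b} = {z}"
      by (auto simp: zero_divisor_graph_def)
    then show "u \<in> verts G \<and> v \<in> verts G \<and> u \<noteq> v \<and> Under r {u, v} = {z}"
      by (metis doubleton_eq_iff)
  qed (auto simp: zero_divisor_graph_def)
  moreover have "u \<noteq> v" if "u \<in> verts G" "atoms_below u \<inter> atoms_below v = {}"
    using that atoms_below_nonempty[of u] by (auto simp: vertex_iff)
  ultimately show ?thesis using Under_pair_eq_least_iff[of u v] vertex_iff by blast
qed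

lemma complement_edge_iff:
  "{u, v} \<in> edges (complement G) \<longleftrightarrow>
    u \<in> verts G \<and> v \<in> verts G \<and> u \<noteq> v \<and> atoms_below u \<inter> atoms_below v \<noteq> {}"
proof -
  have "{u, v} \<in> edges (complement G) \<longleftrightarrow>
      u \<in> verts G \<and> v \<in> verts G \<and> u \<noteq> v \<and> {u, v} \<notin> edges G"
  proof
    assume "{u, v} \<in> edges (complement G)"
    then obtain a b where "{u, v} = {a, b}" "a \<in> verts G" "b \<in> verts G" "a \<noteq> b" "{a, b} \<notin> edges G"
      by (auto simp: complement_def)
    then show "u \<in> verts G \<and> v \<in> verts G \<and> u \<noteq> v \<and> {u, v} \<notin> edges G"
      by (metis doubleton_eq_iff)
  qed (auto simp: complement_def)
  then show ?thesis by (auto simp: edge_iff)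
qed

text \<open>A vertex lies above some atom and fails to lie above another one, so there are at least two
  atoms, and each of them is annihilated by the others.\<close>

lemma atom_vertex:
  assumes "verts G \<noteq> {}" "p \<in> atoms"
  shows "p \<in> verts G"
proof -
  obtain v where v: "v \<in> Field r" "v \<noteq> z" "atoms_below v \<noteq> atoms"
    using assms(1) vertex_iff by blast
  have "atoms \<noteq> {p}"
    using atoms_below_nonempty[OF v(1,2)] v(3) atoms_below_subset[of v] by (metis subset_singletonD)
  then show ?thesis using assms(2) atoms_below_atom[OF assms(2)]
    by (auto simp: vertex_iff atoms_def)
qed

lemma atoms_nonempty: "verts G \<noteq> {} \<Longrightarrow> atoms \<noteq> {}"
  using vertex_iff atoms_below_nonempty atoms_below_subset by blast

text \<open>Let \<open>X p\<close> be the set of vertices above the atom \<open>p\<close>.  It is independent, and a vertex above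
  \<open>i\<close> has no neighbour in \<open>X i\<close>.  If \<open>X p\<close> is smallest possible, then all degrees are
  at most the number of vertices outside \<open>X p\<close>, and \<open>p\<close> attains this bound.\<close>

theorem zero_divisor_graph_TCC: "satisfies_TCC G"
proof (cases "verts G = {}")
  case True
  then show ?thesis by (simp add: satisfies_TCC_def)
next
  case False
  have finV: "finite (verts G)" using G_simple by (simp add: finite_simple_graph_def)
  define X where "X p = {v \<in> verts G. p \<in> atoms_below v}" for p
  obtain p where p: "p \<in> atoms" "\<And>i. i \<in> atoms \<Longrightarrow> card (X p) \<le> card (X i)"
    using ex_is_arg_min_if_finite[OF finite_atoms atoms_nonempty[OF False], of "\<lambda>i. card (X i)"]
    by (auto simp: is_arg_min_linorder)
  define d where "d = card (verts G - X p)"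
  have card_diff: "card (verts G - X i) = card (verts G) - card (X i)" for i
    using finV by (intro card_Diff_subset) (auto simp: X_def)
  have deg_le: "degree G v \<le> d" if v: "v \<in> verts G" for v
  proof -
    obtain i where i: "i \<in> atoms_below v" using atoms_below_nonempty[of v] v vertex_iff by blast
    have "degree G v \<le> card (verts G - X i)"
      unfolding degree_eq_card_neighbours[OF G_simple]
      by (rule card_mono) (use finV i in \<open>auto simp: edge_iff X_def\<close>)
    also have "\<dots> \<le> d" unfolding d_def card_diff
      using p(2)[of i] i atoms_below_subset by (intro diff_le_mono2) blast
    finally show ?thesis .
  qed
  have "\<exists>f g. total_colouring G (d + 2) f g"
  proof (rule total_colouring_of_independent_set[OF G_simple, of "X p"])
    show "X p \<subseteq> verts G" by (auto simp: X_def)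
    show "\<not> e \<subseteq> X p" if "e \<in> edges G" for e
    proof
      assume "e \<subseteq> X p"
      obtain u v where uv: "e = {u, v}"
        using \<open>e \<in> edges G\<close> G_simple by (metis card_2_iff finite_simple_graph_def)
      then show False using that \<open>e \<subseteq> X p\<close> unfolding uv edge_iff by (auto simp: X_def)
    qed
    show "degree G v \<le> d" if "v \<in> verts G" for v using deg_le[OF that] .
    show "card (verts G - X p) \<le> d" by (simp add: d_def)
  qed
  then obtain f g where "total_colouring G (d + 2) f g" by blast
  moreover have "degree G p = d"
  proof -
    have "{u \<in> verts G. {u, p} \<in> edges G} = verts G - X p"
      using atom_vertex[OF False p(1)] atoms_below_atom[OF p(1)] by (auto simp: edge_iff X_def)
    then show ?thesis by (simp add: degree_eq_card_neighbours[OF G_simple] d_def)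
  qed
  ultimately show ?thesis
    using satisfies_TCC_if_total_colouring[OF G_simple _ atom_vertex[OF False p(1)]] by simp
qed

text \<open>For two elements \<open>u\<close> and \<open>b\<close> not above the atom \<open>p\<close>, 0-distributivity says that \<open>p\<close> is not
  below all of their common upper bounds.  By induction the elements not above \<open>p\<close> have a common upper
  bound that is not above \<open>p\<close> either.\<close>

lemma upper_bound_avoiding_atom:
  assumes distr: "zero_distributive r z" and p: "p \<in> atoms"
    and F: "finite F" "F \<subseteq> {x \<in> Field r. (p, x) \<notin> r}"
  shows "\<exists>u \<in> Field r. (p, u) \<notin> r \<and> (\<forall>x\<in>F. (x, u) \<in> r)"
  using F
proof (induction F rule: finite_induct)
  case empty
  have "(p, z) \<notin> r" using p least_le le_antisym by (auto simp: atoms_def)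
  then show ?case using least_in by blast
next
  case (insert b F)
  then obtain u where u: "u \<in> Field r" "(p, u) \<notin> r" "\<forall>x\<in>F. (x, u) \<in> r" by blast
  have b: "b \<in> Field r" "(p, b) \<notin> r" using insert.prems by auto
  have pF: "p \<in> Field r" "p \<noteq> z" using p by (auto simp: atoms_def)
  have "Under r {p, x} = {z}" if "x \<in> Field r" "(p, x) \<notin> r" for x
    using Under_pair_eq_least_iff[OF pF(1) that(1)] atoms_below_atom[OF p] that
    by (simp add: atoms_below_def)
  then have "Under r ({p} \<union> Above r {u, b}) = {z}"
    using distr u b pF(1) unfolding zero_distributive_def by blast
  then have "p \<notin> Under r ({p} \<union> Above r {u, b})" using pF(2) by blast
  then obtain w where w: "w \<in> Above r {u, b}" "(p, w) \<notin> r"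
    using pF(1) le_refl by (auto simp: Under_def)
  then have "w \<in> Field r" "(u, w) \<in> r" "(b, w) \<in> r" by (auto simp: Above_def)
  then show ?case using w(2) u(3) le_trans by blast
qed

text \<open>By 0-distributivity there is an element \<open>u\<close> that lies above every atom but \<open>p\<close>.  In the
  complement it is adjacent to all vertices except itself and those above \<open>p\<close> alone among the
  atoms.  For the atom \<open>p\<close> with the fewest such vertices, the degree of \<open>u\<close> is therefore large enough
  for the number of colours in the colouring of intersection graphs.\<close>

theorem complement_zero_divisor_graph_TCC:
  assumes distr: "zero_distributive r z"
  shows "satisfies_TCC (complement G)"
proof (cases "verts G = {}")
  case True
  then show ?thesis by (simp add: satisfies_TCC_def complement_def)
next
  case False
  let ?H = "complement G"
  have H_simple: "finite_simple_graph ?H" by (rule finite_simple_graph_complement[OF G_simple])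
  have V: "verts ?H = verts G" by (simp add: complement_def)
  have finV: "finite (verts G)" using G_simple by (simp add: finite_simple_graph_def)
  define M where "M p = {v \<in> verts G. atoms_below v = {p}}" for p
  obtain p where p: "p \<in> atoms" "\<And>i. i \<in> atoms \<Longrightarrow> card (M p) \<le> card (M i)"
    using ex_is_arg_min_if_finite[OF finite_atoms atoms_nonempty[OF False], of "\<lambda>i. card (M i)"]
    by (auto simp: is_arg_min_linorder)
  have "p \<in> verts G" using atom_vertex[OF False p(1)] .
  have "atoms - {p} \<subseteq> {x \<in> Field r. (p, x) \<notin> r}"
    using p(1) by (auto simp: atoms_def)
  then obtain u where u: "u \<in> Field r" "(p, u) \<notin> r" "\<forall>x\<in>atoms - {p}. (x, u) \<in> r"
    using upper_bound_avoiding_atom[OF distr p(1)] finite_atoms by blast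
  have Au: "atoms_below u = atoms - {p}" using u by (auto simp: atoms_below_def)
  have "atoms \<noteq> {p}"
    using \<open>p \<in> verts G\<close> atoms_below_atom[OF p(1)] by (auto simp: vertex_iff)
  then obtain i where i: "i \<in> atoms" "i \<noteq> p" using p(1) by blast
  then have "(i, u) \<in> r" using u(3) by blast
  then have "u \<noteq> z" using i(1) le_antisym[of i u] least_le[of i] by (auto simp: atoms_def)
  then have uV: "u \<in> verts G" using u(1) Au p(1) by (auto simp: vertex_iff)
  have "\<exists>f g. total_colouring ?H (card (verts ?H) - card {v \<in> verts ?H. atoms_below v = {p}} + 1) f g"
  proof (rule intersection_graph_total_colouring[OF H_simple, where I = atoms and h = u])
    show "atoms_below v \<inter> atoms_below w \<noteq> {}" if "{v, w} \<in> edges ?H" for v w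
      using that by (simp add: complement_edge_iff)
    show "atoms_below v \<noteq> {} \<and> atoms_below v \<subset> atoms" if "v \<in> verts ?H" for v
      using that atoms_below_nonempty[of v] atoms_below_subset[of v] by (auto simp: V vertex_iff)
    show "card {v \<in> verts ?H. atoms_below v = {p}} \<le> card {v \<in> verts ?H. atoms_below v = {i}}"
      if "i \<in> atoms" for i using p(2)[OF that] by (simp add: V M_def)
  qed (use finite_atoms p(1) uV Au V in auto)
  then obtain f g where col: "total_colouring ?H (card (verts G) - card (M p) + 1) f g"
    by (auto simp: V M_def)
  have "degree ?H u = card (verts G - M p - {u})"
  proof -
    have "{v \<in> verts ?H. {v, u} \<in> edges ?H} = verts G - M p - {u}"
    proof -
      have "atoms_below v \<inter> (atoms - {p}) \<noteq> {} \<longleftrightarrow> atoms_below v \<noteq> {p}" if "v \<in> verts G" for v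
        using atoms_below_nonempty[of v] atoms_below_subset[of v] that by (auto simp: vertex_iff)
      then show ?thesis using uV by (auto simp: V complement_edge_iff Au M_def)
    qed
    then show ?thesis by (simp add: degree_eq_card_neighbours[OF H_simple])
  qed
  also have "\<dots> = card (verts G) - card (M p) - 1"
  proof -
    have "u \<in> verts G - M p" using uV Au by (auto simp: M_def)
    moreover have "card (verts G - M p) = card (verts G) - card (M p)"
      using finV by (intro card_Diff_subset) (auto simp: M_def)
    ultimately show ?thesis using finV by (simp add: card_Diff_singleton)
  qed
  finally have "card (verts G) - card (M p) + 1 \<le> degree ?H u + 2" by simp
  then show ?thesis using satisfies_TCC_if_total_colouring[OF H_simple col] uV V by simp
qed

end

theorem theorem1p2:
  fixes r :: "'a rel" and z :: 'a
  assumes "Partial_order r"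
    and "finite (Field r)"
    and "is_least_element r z"
  shows "satisfies_TCC (zero_divisor_graph r z) \<and>
    (zero_distributive r z \<longrightarrow> satisfies_TCC (complement (zero_divisor_graph r z)))"
proof -
  interpret finite_pointed_poset r z by unfold_locales (fact assms)+
  show ?thesis using zero_divisor_graph_TCC complement_zero_divisor_graph_TCC by blast
qed

end
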